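(* The set of chemical graphs that are extremal for the topological index ABC is exactly $F_8\cup F_9$.
   Context: All graphs are finite, simple and undirected. A chemical graph is a connected graph of order (number of vertices) $n\ge 7$, size (number of edges) $m\le \frac{3n-3}{2}$ and maximum degree at most $3$. For such a graph, $x_{ij}$ ($i\le j$) denotes the number of $(i,j)$-edges, i.e. edges whose endpoints have degrees $i$ and $j$ (necessarily $x_{11}=0$). A degree-based topological index is a function of the form $f(G)=c_{12}x_{12}+c_{13}x_{13}+c_{22}x_{22}+c_{23}x_{23}+c_{33}x_{33}$ with real coefficients $c_{ij}$. The ABC index is the one with $c_{ij}=\sqrt{\frac{i+j-2}{ij}}$. For an integer $a$, $a \bmod 3\in\{0,1,2\}$ denotes the remainder modulo 3. A chemical graph $G$ is extremal for $f$ if it maximizes $f$ or minimizes $f$ over all chemical graphs of the same order and size as $G$. $F_8$ is the set of chemical graphs (of order $n$ and size $m$) with $(x_{12},x_{13},x_{22},x_{23},x_{33})$ equal to - $(2,0,m-2,0,0)$ or $(3,0,m-6,3,0)$ if $m+1=n\in\{7,8,9\}$; - $(2,0,m-7,4,1)$ if $m=n\in\{7,8\}$; - $(1,0,1,3,3)$ if $n=7$ and $m=8$; - $\left(\lfloor\frac{3n-2m}{3}\rfloor,0,m\bmod 3,\lfloor\frac{3n-2m}{3}\rfloor,\lfloor\frac{7m-6n}{3}\rfloor\right)$ otherwise. $F_9$ is the set of chemical graphs (of order $n$ and size $m$) with $(x_{12},x_{13},x_{22},x_{23},x_{33})$ equal to - $\left(0,\frac{6n-5m+(2m\bmod 3)}{3},0,\frac{8m-6n-4(2m\bmod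 3)}{3},2m\bmod 3\right)$ if $n-1\le m\le\frac{6n+2}{5}$; - $(0,0,0,6n-4m,5m-6n)$ if $\frac{6n+3}{5}\le m\le\frac{3n-3}{2}$. *)

theory Defs
  imports Complex_Main
begin

record 'a sgraph =
  verts :: "'a set"
  edges :: "'a set set"

definition simple_graph :: "'a sgraph \<Rightarrow> bool" where
  "simple_graph G \<longleftrightarrow> finite (verts G) \<and> (\<forall>e\<in>edges G. e \<subseteq> verts G \<and> card e = 2)"

definition graph_order :: "'a sgraph \<Rightarrow> nat" where
  "graph_order G = card (verts G)"

definition graph_size :: "'a sgraph \<Rightarrow> nat" where
  "graph_size G = card (edges G)"

definition vertex_degree :: "'a sgraph \<Rightarrow> 'a \<Rightarrow> nat" where
  "vertex_degree G v = card {e \<in> edges G. v \<in> e}"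

definition connected_graph :: "'a sgraph \<Rightarrow> bool" where
  "connected_graph G \<longleftrightarrow>
     (\<forall>u\<in>verts G. \<forall>v\<in>verts G. (u, v) \<in> {(a, b). {a, b} \<in> edges G}\<^sup>*)"

definition chemical_graph :: "'a sgraph \<Rightarrow> bool" where
  "chemical_graph G \<longleftrightarrow>
     simple_graph G \<and> connected_graph G \<and> graph_order G \<ge> 7 \<and>
     real (graph_size G) \<le> (3 * real (graph_order G) - 3) / 2 \<and>
     (\<forall>v\<in>verts G. vertex_degree G v \<le> 3)"

definition edge_count :: "'a sgraph \<Rightarrow> nat \<Rightarrow> nat \<Rightarrow> nat" where
  "edge_count G i j =
     card {e \<in> edges G. \<exists>u v. e = {u, v} \<and> vertex_degree G u = i \<and> vertex_degree G v = j}"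

definition degree_based_index :: "(nat \<Rightarrow> nat \<Rightarrow> real) \<Rightarrow> 'a sgraph \<Rightarrow> real" where
  "degree_based_index c G =
     c 1 2 * real (edge_count G 1 2) + c 1 3 * real (edge_count G 1 3) +
     c 2 2 * real (edge_count G 2 2) + c 2 3 * real (edge_count G 2 3) +
     c 3 3 * real (edge_count G 3 3)"

definition ABC :: "'a sgraph \<Rightarrow> real" where
  "ABC = degree_based_index (\<lambda>i j. sqrt ((real i + real j - 2) / (real i * real j)))"

text \<open>
  The competitors of G live on the same vertex type as G. This is no restriction: that type
  contains the vertices of G, hence an isomorphic copy of every graph of the same order.
\<close>

definition maximizes :: "('a sgraph \<Rightarrow> real) \<Rightarrow> 'a sgraph \<Rightarrow> bool" where
  "maximizes f G \<longleftrightarrow>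
     (\<forall>H. chemical_graph H \<and> graph_order H = graph_order G \<and> graph_size H = graph_size G \<longrightarrow> f H \<le> f G)"

definition minimizes :: "('a sgraph \<Rightarrow> real) \<Rightarrow> 'a sgraph \<Rightarrow> bool" where
  "minimizes f G \<longleftrightarrow>
     (\<forall>H. chemical_graph H \<and> graph_order H = graph_order G \<and> graph_size H = graph_size G \<longrightarrow> f G \<le> f H)"

definition extremal :: "('a sgraph \<Rightarrow> real) \<Rightarrow> 'a sgraph \<Rightarrow> bool" where
  "extremal f G \<longleftrightarrow> chemical_graph G \<and> (maximizes f G \<or> minimizes f G)"

definition edge_vector :: "'a sgraph \<Rightarrow> int \<times> int \<times> int \<times> int \<times> int" where
  "edge_vector G =
     (int (edge_count G 1 2), int (edge_count G 1 3), int (edge_count G 2 2),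
      int (edge_count G 2 3), int (edge_count G 3 3))"

text \<open>
  On integers, div rounds down, so it renders the floors in the first family; in the second
  family all numerators are multiples of 3 and the division is exact.
\<close>

definition F8_vectors :: "int \<Rightarrow> int \<Rightarrow> (int \<times> int \<times> int \<times> int \<times> int) set" where
  "F8_vectors n m =
     (if m + 1 = n \<and> n \<in> {7, 8, 9} then {(2, 0, m - 2, 0, 0), (3, 0, m - 6, 3, 0)}
      else if m = n \<and> n \<in> {7, 8} then {(2, 0, m - 7, 4, 1)}
      else if n = 7 \<and> m = 8 then {(1, 0, 1, 3, 3)}
      else {((3 * n - 2 * m) div 3, 0, m mod 3, (3 * n - 2 * m) div 3, (7 * m - 6 * n) div 3)})"

definition F9_vectors :: "int \<Rightarrow> int \<Rightarrow> (int \<times> int \<times> int \<times> int \<times> int) set" where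
  "F9_vectors n m =
     {v. n - 1 \<le> m \<and> real_of_int m \<le> (6 * real_of_int n + 2) / 5 \<and>
         v = (0, (6 * n - 5 * m + (2 * m) mod 3) div 3, 0,
              (8 * m - 6 * n - 4 * ((2 * m) mod 3)) div 3, (2 * m) mod 3)} \<union>
     {v. (6 * real_of_int n + 3) / 5 \<le> real_of_int m \<and>
         real_of_int m \<le> (3 * real_of_int n - 3) / 2 \<and>
         v = (0, 0, 0, 6 * n - 4 * m, 5 * m - 6 * n)}"

definition F8 :: "'a sgraph set" where
  "F8 = {G. chemical_graph G \<and> edge_vector G \<in> F8_vectors (int (graph_order G)) (int (graph_size G))}"

definition F9 :: "'a sgraph set" where
  "F9 = {G. chemical_graph G \<and> edge_vector G \<in> F9_vectors (int (graph_order G)) (int (graph_size G))}"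

end

theory Submission
  imports Defs "HOL-Library.Multiset"
begin

text \<open>
  Write (a, b, c, d, e) for (x12, x13, x22, x23, x33). The coefficients of
  x12, x22 and x23 in the ABC index all equal \<surd>(1/2), so on graphs of size m
  the index is \<surd>(1/2) m + \<alpha> b - \<beta> e with \<alpha> = \<surd>(2/3) - \<surd>(1/2) and
  \<beta> = \<surd>(1/2) - 2/3. The whole argument is integer arithmetic with the numbers of edges of each
  type; about \<alpha> and \<beta> it uses only 0 < 2\<beta> < \<alpha> < 3\<beta>.

  Counting vertices through the degrees of the endpoints of edges gives 9a + 8b + 6c + 5d + 4e = 6n,
  and a + b + c + d + e = m; hence e = 3b - (6n - 5m) + (4a + c).

  For the maximum this identity suffices. Trading leaves against (3,3)-edges along it, a vector that
  scores at least as high as the one with a = c = 0 and the smallest possible e must coincide with it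
  (score_ge_imp_same_leaf_count). This is the family F9.

  For the minimum put d = a + 2h. The two equations become 3a + 2b + c + h = 3n - 2m and
  e = 3(m - n) + a + b - h. A graph that scores at most as high as a vector without leaves and with
  e' edges of type (3,3) satisfies e' + 2b \<le> e (score_le_imp_more_33_edges), so
  a - b - h is bounded below. In a connected graph every pendant path ends in a cubic vertex unless
  the graph is itself a path, whence h \<ge> 0 (pendant_paths_end_at_cubic_vertices); and
  3a \<le> 3n - 2m then forces b = h = 0 and a = \<lfloor>(3n - 2m)/3\<rfloor>. This is the regular part of F8. The
  listed exceptions are the small trees, where the path ties with the optimum, and three pairs (n, m)
  for which the regular vector asks for more (3,3)-edges than its two or three cubic vertices can
  span in a simple graph.

  Both bounds say something about extremal graphs only if they are attained. The required graphs arise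
  from a few small ones by subdividing edges, hanging leaves on subdivided edges, and joining the
  midpoints of two edges. None of these operations changes the degree of an old vertex, so their effect
  on the edge types is immediate; everything else is relabelling of vertices.
\<close>

section \<open>Edge types and subcubic graphs\<close>

text \<open>
  As a set of degrees, a type does not depend on an order of the endpoints; a type with two equal
  degrees is a singleton.
\<close>

definition edge_type :: "'a sgraph \<Rightarrow> 'a set \<Rightarrow> nat set" where
  "edge_type G e = vertex_degree G ` e"

definition type_mset :: "'a sgraph \<Rightarrow> nat set multiset" where
  "type_mset G = image_mset (edge_type G) (mset_set (edges G))"

text \<open>
  The class of graphs in which the counting takes place. Chemical graphs belong to it, and it is closed
  under the constructions below, which start from graphs with fewer than seven vertices. Three vertices
  are what excludes an edge that joins two leaves.
\<close>

definition subcubic :: "'a sgraph \<Rightarrow> bool" where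
  "subcubic G \<longleftrightarrow> simple_graph G \<and> connected_graph G \<and>
     (\<forall>v\<in>verts G. vertex_degree G v \<le> 3) \<and> 3 \<le> graph_order G"

lemma chemical_imp_subcubic: "chemical_graph G \<Longrightarrow> subcubic G"
  by (auto simp: chemical_graph_def subcubic_def)

lemma finite_edges: "simple_graph G \<Longrightarrow> finite (edges G)"
  unfolding simple_graph_def by (meson PowI finite_Pow_iff finite_subset subsetI)

lemma edge_endpoints:
  assumes "simple_graph G" "e \<in> edges G"
  obtains u v where "e = {u, v}" "u \<noteq> v" "u \<in> verts G" "v \<in> verts G"
proof -
  have "e \<subseteq> verts G" "card e = 2" using assms by (auto simp: simple_graph_def)
  then show ?thesis using that by (auto simp: card_2_iff)
qed

lemma edge_count_eq_card:
  assumes "simple_graph G"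
  shows "edge_count G i j = card {e \<in> edges G. edge_type G e = {i, j}}"
proof -
  have "(\<exists>u v. e = {u, v} \<and> vertex_degree G u = i \<and> vertex_degree G v = j)
      \<longleftrightarrow> edge_type G e = {i, j}" if e: "e \<in> edges G" for e
  proof -
    obtain u v where uv: "e = {u, v}" using edge_endpoints[OF assms e] by metis
    show ?thesis unfolding edge_type_def uv by (auto simp: doubleton_eq_iff)
  qed
  then show ?thesis unfolding edge_count_def by (intro arg_cong[where f = card]) blast
qed

lemma edge_count_eq_count:
  assumes "simple_graph G"
  shows "edge_count G i j = count (type_mset G) {i, j}"
proof -
  have "count (type_mset G) {i, j} = card {e \<in> edges G. edge_type G e = {i, j}}"
    using finite_edges[OF assms]
    by (simp add: type_mset_def count_image_mset Int_def vimage_def conj_commute)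
  then show ?thesis using edge_count_eq_card[OF assms] by simp
qed

section \<open>Connectivity\<close>

lemma crossing_edge:
  assumes "simple_graph G" "connected_graph G" "S \<subset> verts G" "S \<noteq> {}"
  obtains u v where "{u, v} \<in> edges G" "u \<in> S" "v \<in> verts G - S"
proof -
  obtain s t where st: "s \<in> S" "t \<in> verts G" "t \<notin> S" using assms(3,4) by blast
  have "(s, t) \<in> {(a, b). {a, b} \<in> edges G}\<^sup>*"
    using assms(2,3) st unfolding connected_graph_def by blast
  then have "t \<in> S \<or> (\<exists>u v. {u, v} \<in> edges G \<and> u \<in> S \<and> v \<in> verts G - S)"
  proof (induction rule: rtrancl_induct)
    case (step y z)
    have "z \<in> verts G" using step(2) assms(1) by (auto simp: simple_graph_def)
    then show ?case using step by blast
  qed (use st in simp)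
  then show ?thesis using st that by blast
qed

text \<open>
  Grow the set one vertex at a time along an edge that leaves it: each new vertex uses up an edge that
  was not yet inside. With a singleton this is the bound by a spanning tree; with the set of cubic
  vertices it controls the pendant paths.
\<close>

lemma vertices_outside_le_edges_leaving:
  assumes "simple_graph G" "connected_graph G" "S \<subseteq> verts G" "S \<noteq> {}"
  shows "card (verts G - S) \<le> card {e \<in> edges G. \<not> e \<subseteq> S}"
  using assms(3,4)
proof (induction "card (verts G - S)" arbitrary: S)
  case (Suc k)
  have fV: "finite (verts G)" using assms(1) by (simp add: simple_graph_def)
  have "S \<subset> verts G" using Suc by fastforce
  then obtain u v where uv: "{u, v} \<in> edges G" "u \<in> S" "v \<in> verts G - S"
    using crossing_edge[OF assms(1,2)] Suc.prems(2) by metis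
  have Veq: "verts G - S = insert v (verts G - insert v S)" using uv by blast
  have c: "card (verts G - S) = Suc (card (verts G - insert v S))"
    using fV by (subst Veq) simp
  then have k: "k = card (verts G - insert v S)" using Suc.hyps(2) by simp
  have fin: "finite {e \<in> edges G. \<not> e \<subseteq> S}" using finite_edges[OF assms(1)] by simp
  have "card (verts G - insert v S) \<le> card {e \<in> edges G. \<not> e \<subseteq> insert v S}"
    using Suc.hyps(1)[OF k] uv(3) Suc.prems by blast
  also have "\<dots> < card {e \<in> edges G. \<not> e \<subseteq> S}"
  proof (rule psubset_card_mono[OF fin psubsetI])
    show "{e \<in> edges G. \<not> e \<subseteq> insert v S} \<subseteq> {e \<in> edges G. \<not> e \<subseteq> S}" by auto
    have "{u, v} \<in> {e \<in> edges G. \<not> e \<subseteq> S} - {e \<in> edges G. \<not> e \<subseteq> insert v S}"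
      using uv by auto
    then show "{e \<in> edges G. \<not> e \<subseteq> insert v S} \<noteq> {e \<in> edges G. \<not> e \<subseteq> S}" by (metis Diff_cancel empty_iff)
  qed
  finally show ?case using c by simp
qed simp

lemma size_ge_order_minus_one:
  assumes "subcubic G"
  shows "graph_order G \<le> graph_size G + 1"
proof -
  have s: "simple_graph G" "connected_graph G" "3 \<le> card (verts G)"
    using assms by (auto simp: subcubic_def graph_order_def)
  obtain v where v: "v \<in> verts G" using s(3) by fastforce
  have "card (verts G - {v}) \<le> card {e \<in> edges G. \<not> e \<subseteq> {v}}"
    using vertices_outside_le_edges_leaving[OF s(1,2)] v by blast
  also have "\<dots> \<le> card (edges G)" by (intro card_mono finite_edges s) auto
  finally show ?thesis using v by (simp add: graph_order_def graph_size_def)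
qed

lemma degree_ge_two_if_two_edges:
  assumes "simple_graph G" "e \<in> edges G" "f \<in> edges G" "e \<noteq> f" "v \<in> e" "v \<in> f"
  shows "2 \<le> vertex_degree G v"
proof -
  have "card {e, f} \<le> card {e \<in> edges G. v \<in> e}"
    by (rule card_mono) (use assms finite_edges[OF assms(1)] in auto)
  then show ?thesis using assms(4) by (simp add: vertex_degree_def)
qed

lemma subcubic_degree_pos:
  assumes "subcubic G" "v \<in> verts G"
  shows "1 \<le> vertex_degree G v"
proof -
  have s: "simple_graph G" "connected_graph G" "3 \<le> card (verts G)"
    using assms by (auto simp: subcubic_def graph_order_def)
  have "verts G \<noteq> {v}" using s(3) by auto
  then have "{v} \<subset> verts G" using assms(2) by blast
  then obtain w where "{v, w} \<in> edges G" using crossing_edge[OF s(1,2)] by blast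
  then have "{e \<in> edges G. v \<in> e} \<noteq> {}" by blast
  then show ?thesis using finite_edges[OF s(1)] by (simp add: vertex_degree_def Suc_le_eq card_gt_0_iff)
qed

section \<open>Counting vertices and edges by degree\<close>

text \<open>
  An edge that joins two leaves would be a connected component with two vertices.
\<close>

lemma subcubic_edge_type:
  assumes "subcubic G" "e \<in> edges G"
  shows "edge_type G e \<in> {{1,2}, {1,3}, {2,2}, {2,3}, {3,3}}"
proof -
  have s: "simple_graph G" "connected_graph G" "3 \<le> card (verts G)"
      "\<forall>v\<in>verts G. vertex_degree G v \<le> 3"
    using assms by (auto simp: subcubic_def graph_order_def)
  obtain u v where e: "e = {u, v}" "u \<noteq> v" "u \<in> verts G" "v \<in> verts G"
    using edge_endpoints[OF s(1) assms(2)] by metis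
  have "\<not> (vertex_degree G u = 1 \<and> vertex_degree G v = 1)"
  proof
    assume d: "vertex_degree G u = 1 \<and> vertex_degree G v = 1"
    have "verts G \<noteq> {u, v}" using e(2) s(3) by auto
    then have "{u, v} \<subset> verts G" using e by blast
    then obtain x y where xy: "{x, y} \<in> edges G" "x \<in> {u, v}" "y \<in> verts G - {u, v}"
      using crossing_edge[OF s(1,2)] by blast
    have "2 \<le> vertex_degree G x"
      by (rule degree_ge_two_if_two_edges[OF s(1) assms(2) xy(1)]) (use xy e in auto)
    then show False using d xy(2) by auto
  qed
  moreover have "vertex_degree G u \<in> {1,2,3}" "vertex_degree G v \<in> {1,2,3}"
    using subcubic_degree_pos[OF assms(1)] s(4) e by fastforce+
  ultimately show ?thesis unfolding e(1) edge_type_def by (auto simp: insert_commute)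
qed

lemma sum_over_edges_by_type:
  fixes h :: "'a set \<Rightarrow> nat"
  assumes G: "subcubic G"
    and h: "\<And>u v. {u, v} \<in> edges G \<Longrightarrow> u \<noteq> v \<Longrightarrow> h {u, v} = w (vertex_degree G u) + w (vertex_degree G v)"
  shows "(\<Sum>e\<in>edges G. h e) =
    (w 1 + w 2) * edge_count G 1 2 + (w 1 + w 3) * edge_count G 1 3 +
    2 * w 2 * edge_count G 2 2 + (w 2 + w 3) * edge_count G 2 3 + 2 * w 3 * edge_count G 3 3"
proof -
  have s: "simple_graph G" using G by (simp add: subcubic_def)
  let ?T = "{{1,2}, {1,3}, {2,2}, {2,3}, {3,3}} :: nat set set"
  have class_sum: "(\<Sum>e | e \<in> edges G \<and> edge_type G e = {i, j}. h e) = (w i + w j) * edge_count G i j" for i j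
  proof -
    have "h e = w i + w j" if t: "e \<in> edges G" "edge_type G e = {i, j}" for e
    proof -
      obtain u v where e: "e = {u, v}" "u \<noteq> v" using edge_endpoints[OF s t(1)] by metis
      have "{vertex_degree G u, vertex_degree G v} = {i, j}" using t(2) e by (simp add: edge_type_def)
      then show ?thesis using h[of u v] t(1) e by (auto simp: doubleton_eq_iff)
    qed
    then show ?thesis by (simp add: edge_count_eq_card[OF s])
  qed
  have "(\<Sum>e\<in>edges G. h e) = (\<Sum>t\<in>?T. \<Sum>e | e \<in> edges G \<and> edge_type G e = t. h e)"
    by (rule sum.group[symmetric]) (use subcubic_edge_type[OF G] finite_edges[OF s] in auto)
  also have "\<dots> = (w 1 + w 2) * edge_count G 1 2 + (w 1 + w 3) * edge_count G 1 3 +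
    2 * w 2 * edge_count G 2 2 + (w 2 + w 3) * edge_count G 2 3 + 2 * w 3 * edge_count G 3 3"
  proof -
    have d: "{1,2} \<notin> {{1,3}, {2,2}, {2,3}, {3,3::nat}}" "{1,3} \<notin> {{2,2}, {2,3}, {3,3::nat}}"
      "{2,2} \<notin> {{2,3}, {3,3::nat}}" "{2,3} \<notin> {{3,3::nat}}"
      by (auto simp: doubleton_eq_iff)
    show ?thesis
      by (simp only: sum.insert[OF _ d(1)] sum.insert[OF _ d(2)] sum.insert[OF _ d(3)] sum.insert[OF _ d(4)]
          sum.insert[of "{}"] finite.intros empty_iff not_False_eq_True sum.empty class_sum) (simp add: algebra_simps)
  qed
  finally show ?thesis .
qed

text \<open>
  Double counting of incidences, where an incidence at a vertex of degree i has weight w(i). The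
  weight 6/i counts vertices, and the indicator of i = 3 counts cubic vertices.
\<close>

lemma weighted_handshake:
  fixes w :: "nat \<Rightarrow> nat"
  assumes G: "subcubic G"
  shows "(\<Sum>v\<in>verts G. vertex_degree G v * w (vertex_degree G v)) =
    (w 1 + w 2) * edge_count G 1 2 + (w 1 + w 3) * edge_count G 1 3 +
    2 * w 2 * edge_count G 2 2 + (w 2 + w 3) * edge_count G 2 3 + 2 * w 3 * edge_count G 3 3"
proof -
  have s: "simple_graph G" using G by (simp add: subcubic_def)
  have fV: "finite (verts G)" using s by (simp add: simple_graph_def)
  let ?g = "\<lambda>v. w (vertex_degree G v)"
  have "(\<Sum>v\<in>verts G. vertex_degree G v * ?g v) = (\<Sum>v\<in>verts G. \<Sum>e | e \<in> edges G \<and> v \<in> e. ?g v)"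
    by (simp add: vertex_degree_def)
  also have "\<dots> = (\<Sum>e\<in>edges G. \<Sum>v | v \<in> verts G \<and> v \<in> e. ?g v)"
    by (rule sum.swap_restrict[OF fV finite_edges[OF s]])
  also have "\<dots> = (\<Sum>e\<in>edges G. \<Sum>v\<in>e. ?g v)"
    by (intro sum.cong refl) (use s in \<open>auto simp: simple_graph_def\<close>)
  finally show ?thesis using sum_over_edges_by_type[OF G, of "\<lambda>e. \<Sum>v\<in>e. ?g v" w] by simp
qed

lemma size_eq_sum_edge_counts:
  assumes "subcubic G"
  shows "graph_size G = edge_count G 1 2 + edge_count G 1 3 + edge_count G 2 2
    + edge_count G 2 3 + edge_count G 3 3"
proof -
  have "2 * graph_size G = (\<Sum>e\<in>edges G. 2)" by (simp add: graph_size_def)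
  also note sum_over_edges_by_type[OF assms, of "\<lambda>_. 2" "\<lambda>_. 1"]
  finally show ?thesis by simp
qed

lemma order_eq_weighted_edge_counts:
  assumes G: "subcubic G"
  shows "6 * graph_order G = 9 * edge_count G 1 2 + 8 * edge_count G 1 3 + 6 * edge_count G 2 2
    + 5 * edge_count G 2 3 + 4 * edge_count G 3 3"
proof -
  have "vertex_degree G v * (6 div vertex_degree G v) = 6" if "v \<in> verts G" for v
  proof -
    have "vertex_degree G v \<in> {1,2,3}"
      using subcubic_degree_pos[OF G that] G that by (fastforce simp: subcubic_def)
    then show ?thesis by auto
  qed
  then have "6 * graph_order G = (\<Sum>v\<in>verts G. vertex_degree G v * (6 div vertex_degree G v))"
    by (simp add: graph_order_def)
  also note weighted_handshake[OF G, of "\<lambda>i. 6 div i"]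
  finally show ?thesis by simp
qed

lemma three_times_cubic_vertices:
  assumes G: "subcubic G"
  shows "3 * card {v \<in> verts G. vertex_degree G v = 3} =
    edge_count G 1 3 + edge_count G 2 3 + 2 * edge_count G 3 3"
proof -
  have fV: "finite (verts G)" using G by (simp add: subcubic_def simple_graph_def)
  have "3 * card {v \<in> verts G. vertex_degree G v = 3} = (\<Sum>v | v \<in> verts G \<and> vertex_degree G v = 3. 3)"
    by simp
  also have "\<dots> = (\<Sum>v\<in>verts G. vertex_degree G v * of_bool (vertex_degree G v = 3))"
    using fV by (intro sum.mono_neutral_cong_left) auto
  also note weighted_handshake[OF G, of "\<lambda>i. of_bool (i = 3)"]
  finally show ?thesis by simp
qed

lemma edge_count_33_le:
  assumes "subcubic G"
  shows "edge_count G 3 3 \<le> card {v \<in> verts G. vertex_degree G v = 3} choose 2"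
proof -
  let ?V = "{v \<in> verts G. vertex_degree G v = 3}"
  have s: "simple_graph G" using assms by (simp add: subcubic_def)
  have f: "finite ?V" using s by (simp add: simple_graph_def)
  have "edge_count G 3 3 \<le> card {B. B \<subseteq> ?V \<and> card B = 2}"
    unfolding edge_count_eq_card[OF s]
    by (rule card_mono) (use f s in \<open>auto simp: simple_graph_def edge_type_def\<close>)
  then show ?thesis using n_subsets[OF f] by simp
qed

text \<open>
  A path that starts in a leaf with a neighbour of degree 2 runs through vertices of degree 2 until it
  meets a cubic vertex, and different leaves give different last edges. The proof avoids following
  paths: the edges not inside the set of cubic vertices are at least as many as the other vertices,
  and counting both sides by edge type leaves exactly the claim.
\<close>

lemma pendant_paths_end_at_cubic_vertices:
  assumes G: "subcubic G"
    and cubic: "v \<in> verts G" "vertex_degree G v = 3"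
  shows "edge_count G 1 2 \<le> edge_count G 2 3"
proof -
  let ?S = "{v \<in> verts G. vertex_degree G v = 3}"
  have s: "simple_graph G" "connected_graph G" using G by (auto simp: subcubic_def)
  have fV: "finite (verts G)" using s by (simp add: simple_graph_def)
  have "card (verts G) = card ?S + card (verts G - ?S)"
    using fV by (metis (lifting) card_Diff_subset card_mono finite_subset le_add_diff_inverse mem_Collect_eq subsetI)
  moreover have "card (edges G) = card {e \<in> edges G. edge_type G e = {3,3}} + card {e \<in> edges G. \<not> e \<subseteq> ?S}"
  proof -
    have "edge_type G e = {3,3} \<longleftrightarrow> e \<subseteq> ?S" if e: "e \<in> edges G" for e
    proof -
      obtain u v where "e = {u, v}" "u \<in> verts G" "v \<in> verts G"
        using edge_endpoints[OF s(1) e] by metis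
      then show ?thesis by (auto simp: edge_type_def)
    qed
    then have "edges G = {e \<in> edges G. edge_type G e = {3,3}} \<union> {e \<in> edges G. \<not> e \<subseteq> ?S}"
      "{e \<in> edges G. edge_type G e = {3,3}} \<inter> {e \<in> edges G. \<not> e \<subseteq> ?S} = {}" by blast+
    then show ?thesis using finite_edges[OF s(1)] by (metis (lifting) card_Un_disjoint finite_Un)
  qed
  moreover have "card (verts G - ?S) \<le> card {e \<in> edges G. \<not> e \<subseteq> ?S}"
    by (rule vertices_outside_le_edges_leaving[OF s]) (use cubic in auto)
  ultimately show ?thesis
    using size_eq_sum_edge_counts[OF G] order_eq_weighted_edge_counts[OF G] three_times_cubic_vertices[OF G]
      edge_count_eq_card[OF s(1), of 3 3]
    by (simp add: graph_order_def graph_size_def)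
qed

section \<open>Replacing edges without changing degrees\<close>

abbreviation adj :: "'a set set \<Rightarrow> ('a \<times> 'a) set" where
  "adj E \<equiv> {(a, b). {a, b} \<in> E}"

lemma adj_rtrancl_sym: "(u, v) \<in> (adj E)\<^sup>* \<Longrightarrow> (v, u) \<in> (adj E)\<^sup>*"
  by (rule symD[OF sym_rtrancl]) (auto simp: sym_def insert_commute)

lemma card_incident_eq_sum:
  "finite E \<Longrightarrow> card {e \<in> E. v \<in> e} = (\<Sum>e\<in>E. if v \<in> e then 1 else 0)"
  by (simp add: sum.If_cases Int_def)

text \<open>
  The common core of all constructions: the edges F give way to edges E', each of which has an
  endpoint among the new vertices W. If F and E' cover each old vertex equally often, old degrees and
  hence the types of the remaining edges persist; if E' links the endpoints of every edge of F and
  reaches every new vertex, connectivity persists.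
\<close>

lemma replace_edges:
  fixes G :: "'a sgraph"
  defines "deg' \<equiv> \<lambda>E' v. if v \<in> verts G then vertex_degree G v else card {e \<in> E'. v \<in> e}"
  assumes G: "subcubic G"
    and F: "F \<subseteq> edges G"
    and W: "finite W" "W \<inter> verts G = {}"
    and E': "finite E'" "\<And>e. e \<in> E' \<Longrightarrow> card e = 2 \<and> e \<subseteq> verts G \<union> W \<and> e \<inter> W \<noteq> {}"
    and old_degree: "\<And>v. v \<in> verts G \<Longrightarrow> card {e \<in> E'. v \<in> e} = card {e \<in> F. v \<in> e}"
    and new_degree: "\<And>w. w \<in> W \<Longrightarrow> card {e \<in> E'. w \<in> e} \<le> 3"
    and old_path: "\<And>u v. {u, v} \<in> F \<Longrightarrow> (u, v) \<in> (adj E')\<^sup>*"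
    and new_path: "\<And>w. w \<in> W \<Longrightarrow> \<exists>v\<in>verts G. (v, w) \<in> (adj E')\<^sup>*"
  shows "\<exists>H :: 'a sgraph. subcubic H \<and>
    type_mset H = type_mset G - image_mset (edge_type G) (mset_set F)
      + image_mset (\<lambda>e. deg' E' ` e) (mset_set E')"
proof -
  define H :: "'a sgraph" where "H = \<lparr>verts = verts G \<union> W, edges = (edges G - F) \<union> E'\<rparr>"
  have s: "simple_graph G" "connected_graph G" "\<And>v. v \<in> verts G \<Longrightarrow> vertex_degree G v \<le> 3"
      "3 \<le> card (verts G)"
    using G by (auto simp: subcubic_def graph_order_def)
  have fE: "finite (edges G)" using finite_edges[OF s(1)] .
  have fV: "finite (verts G)" using s(1) by (simp add: simple_graph_def)
  have fF: "finite F" using F fE finite_subset by blast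
  have eV: "e \<subseteq> verts G" if "e \<in> edges G" for e using s(1) that by (simp add: simple_graph_def)
  have disj: "(edges G - F) \<inter> E' = {}" using eV E'(2) W(2) by blast
  have degree: "vertex_degree H v = deg' E' v" if "v \<in> verts G \<union> W" for v
  proof -
    have "{e \<in> edges H. v \<in> e} = ({e \<in> edges G. v \<in> e} - {e \<in> F. v \<in> e}) \<union> {e \<in> E'. v \<in> e}"
      by (auto simp: H_def)
    moreover have "card \<dots> = card ({e \<in> edges G. v \<in> e} - {e \<in> F. v \<in> e}) + card {e \<in> E'. v \<in> e}"
      using fE E'(1) disj by (intro card_Un_disjoint) auto
    moreover have "card ({e \<in> edges G. v \<in> e} - {e \<in> F. v \<in> e}) = vertex_degree G v - card {e \<in> F. v \<in> e}"
      unfolding vertex_degree_def using fF F by (intro card_Diff_subset) auto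
    moreover have "card {e \<in> F. v \<in> e} \<le> vertex_degree G v"
      unfolding vertex_degree_def using fE F by (intro card_mono) auto
    ultimately have d: "vertex_degree H v + card {e \<in> F. v \<in> e} = vertex_degree G v + card {e \<in> E'. v \<in> e}"
      unfolding vertex_degree_def[of H] by simp
    show ?thesis
    proof (cases "v \<in> verts G")
      case True
      then show ?thesis using d old_degree[OF True] by (simp add: deg'_def)
    next
      case False
      then have none: "{e \<in> edges G. v \<in> e} = {}" "{e \<in> F. v \<in> e} = {}" using eV F by blast+
      then have "vertex_degree G v = 0" unfolding vertex_degree_def by (simp only: card.empty)
      then show ?thesis using d False none(2) by (simp only: deg'_def card.empty if_False)
    qed
  qed
  have simple: "simple_graph H"
    using s(1) E'(2) fV W(1) by (auto simp: simple_graph_def H_def)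
  have "adj (edges G) \<subseteq> (adj (edges H))\<^sup>*"
  proof clarify
    fix u v assume uv: "{u, v} \<in> edges G"
    have "(u, v) \<in> (adj E')\<^sup>*" if "{u, v} \<in> F" using old_path that by blast
    moreover have "(adj E')\<^sup>* \<subseteq> (adj (edges H))\<^sup>*" by (rule rtrancl_mono) (auto simp: H_def)
    moreover have "(u, v) \<in> (adj (edges H))\<^sup>*" if "{u, v} \<notin> F" using that uv by (auto simp: H_def)
    ultimately show "(u, v) \<in> (adj (edges H))\<^sup>*" by blast
  qed
  then have old: "(adj (edges G))\<^sup>* \<subseteq> (adj (edges H))\<^sup>*" by (rule rtrancl_subset_rtrancl)
  have E'H: "(adj E')\<^sup>* \<subseteq> (adj (edges H))\<^sup>*" by (rule rtrancl_mono) (auto simp: H_def)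
  have reach: "\<exists>x\<in>verts G. (x, v) \<in> (adj (edges H))\<^sup>*" if "v \<in> verts H" for v
    using that new_path E'H by (auto simp: H_def)
  have connected: "connected_graph H"
    unfolding connected_graph_def
  proof (intro ballI)
    fix u v assume "u \<in> verts H" "v \<in> verts H"
    then obtain x y where xy: "x \<in> verts G" "y \<in> verts G"
        "(x, u) \<in> (adj (edges H))\<^sup>*" "(y, v) \<in> (adj (edges H))\<^sup>*"
      using reach by meson
    have "(x, y) \<in> (adj (edges H))\<^sup>*" using s(2) xy(1,2) old by (auto simp: connected_graph_def)
    then show "(u, v) \<in> (adj (edges H))\<^sup>*" using adj_rtrancl_sym[OF xy(3)] xy(4) by simp
  qed
  have "vertex_degree H v \<le> 3" if "v \<in> verts H" for v
    using that degree[of v] s(3)[of v] new_degree[of v] by (auto simp: H_def deg'_def)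
  moreover have "3 \<le> graph_order H"
    using s(4) card_mono[of "verts G \<union> W" "verts G"] fV W(1) by (simp add: graph_order_def H_def)
  ultimately have "subcubic H" using simple connected by (simp add: subcubic_def)
  moreover have "type_mset H = type_mset G - image_mset (edge_type G) (mset_set F)
      + image_mset (\<lambda>e. deg' E' ` e) (mset_set E')"
  proof -
    have "mset_set (edges H) = (mset_set (edges G) - mset_set F) + mset_set E'"
      using mset_set_Union[of "edges G - F" E'] mset_set_Diff[OF fE F] disj fE E'(1)
      by (simp add: H_def)
    moreover have "edge_type H e = edge_type G e" if "e \<in> edges G" for e
      using degree eV[OF that] by (force simp: edge_type_def deg'_def image_iff)
    moreover have "edge_type H e = deg' E' ` e" if "e \<in> E'" for e
      unfolding edge_type_def using degree E'(2)[OF that] by (intro image_cong) auto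
    moreover have sub: "mset_set F \<subseteq># mset_set (edges G)" using F fE fF by simp
    ultimately show ?thesis
      using fE E'(1) fF F unfolding type_mset_def image_mset_Diff[OF sub, symmetric]
      by (auto intro!: image_mset_cong arg_cong2[where f = "(+)"] simp flip: mset_set_Diff)
  qed
  ultimately show ?thesis by blast
qed

lemma edge_of_type:
  assumes "simple_graph G" "type_mset G = add_mset {i, j} N"
  obtains u v where "{u, v} \<in> edges G" "u \<noteq> v" "u \<in> verts G" "v \<in> verts G"
    "vertex_degree G u = i" "vertex_degree G v = j"
    "image_mset (edge_type G) (mset_set (edges G - {{u, v}})) = N"
proof -
  have fE: "finite (edges G)" using finite_edges[OF assms(1)] .
  have "{i, j} \<in># type_mset G" using assms(2) by simp
  then obtain e where e: "e \<in> edges G" "edge_type G e = {i, j}"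
    using fE by (auto simp: type_mset_def)
  obtain x y where xy: "e = {x, y}" "x \<noteq> y" "x \<in> verts G" "y \<in> verts G"
    using edge_endpoints[OF assms(1) e(1)] by metis
  have N: "image_mset (edge_type G) (mset_set (edges G - {e})) = N"
    using assms(2) mset_set.remove[OF fE e(1)] e(2) by (simp add: type_mset_def)
  have "(vertex_degree G x = i \<and> vertex_degree G y = j) \<or> (vertex_degree G y = i \<and> vertex_degree G x = j)"
    using e(2) xy(1) by (auto simp: edge_type_def doubleton_eq_iff)
  then show ?thesis
    using that[of x y] that[of y x] xy e(1) N by (auto simp: insert_commute)
qed

lemma fresh_vertices:
  assumes "finite (A :: nat set)"
  obtains w z where "w \<notin> A" "z \<notin> A" "w \<noteq> z"
proof -
  obtain w where w: "w \<notin> A" using ex_new_if_finite[OF infinite_UNIV_nat assms] by blast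
  obtain z where "z \<notin> insert w A" using ex_new_if_finite[OF infinite_UNIV_nat] assms by blast
  then show ?thesis using that w by blast
qed

lemma adj_edge: "{u, v} \<in> E \<Longrightarrow> (u, v) \<in> (adj E)\<^sup>*" by auto

lemma adj_edge2: "{u, w} \<in> E \<Longrightarrow> {w, v} \<in> E \<Longrightarrow> (u, v) \<in> (adj E)\<^sup>*"
  by (rule rtrancl_trans[OF adj_edge adj_edge])

text \<open>
  In each of the following constructions the old vertices are covered by the replaced and by the
  replacing edges alike, because an edge is only cut into two halves at a new vertex.
\<close>

lemma subdivide:
  fixes G :: "nat sgraph"
  assumes G: "subcubic G" and t: "type_mset G = add_mset {i, j} N"
  shows "\<exists>H :: nat sgraph. subcubic H \<and> type_mset H = N + {#{i, 2}, {2, j}#}"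
proof -
  have s: "simple_graph G" using G by (simp add: subcubic_def)
  obtain u v where uv: "{u, v} \<in> edges G" "u \<noteq> v" "u \<in> verts G" "v \<in> verts G"
    "vertex_degree G u = i" "vertex_degree G v = j" using edge_of_type[OF s t] by metis
  have ty: "edge_type G {u, v} = {i, j}" using uv by (simp add: edge_type_def)
  have "finite (verts G)" using s by (simp add: simple_graph_def)
  then obtain w z where w: "w \<notin> verts G" "z \<notin> verts G" "w \<noteq> z" by (rule fresh_vertices)
  have ne: "u \<noteq> w" "v \<noteq> w" using uv w by auto
  let ?E' = "{{u, w}, {w, v}}"
  have dist: "{u, w} \<noteq> {w, v}" using uv(2) by (auto simp: doubleton_eq_iff)
  have deg_new: "card {e \<in> ?E'. a \<in> e} = (if a \<in> {u, w} then 1 else 0) + (if a \<in> {w, v} then 1 else 0)" for a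
    by (subst card_incident_eq_sum) (use dist in simp_all)
  have deg_old: "card {e \<in> {{u, v}}. a \<in> e} = (if a \<in> {u, v} then 1 else 0)" for a
    by (subst card_incident_eq_sum) simp_all
  have "\<exists>H :: nat sgraph. subcubic H \<and>
    type_mset H = type_mset G - image_mset (edge_type G) (mset_set {{u, v}})
      + image_mset (\<lambda>e. (\<lambda>x. if x \<in> verts G then vertex_degree G x else card {e \<in> ?E'. x \<in> e}) ` e)
        (mset_set ?E')"
  proof (rule replace_edges[OF G, where W = "{w}"])
    show "(x, y) \<in> (adj ?E')\<^sup>*" if "{x, y} \<in> {{u, v}}" for x y
      using that adj_edge2[of u w ?E' v] adj_edge2[of v w ?E' u] by (auto simp: doubleton_eq_iff insert_commute)
    show "\<exists>v\<in>verts G. (v, x) \<in> (adj ?E')\<^sup>*" if "x \<in> {w}" for x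
      using that uv(3) by auto
    show "card {e \<in> ?E'. x \<in> e} = card {e \<in> {{u, v}}. x \<in> e}" if "x \<in> verts G" for x
    proof -
      have "x \<noteq> w" "x \<noteq> z" using that w by auto
      then show ?thesis using uv(2) unfolding deg_new deg_old by simp
    qed
    show "card {e \<in> ?E'. x \<in> e} \<le> 3" if "x \<in> {w}" for x
      using that ne w(3) unfolding deg_new by auto
  qed (use uv w ne in auto)
  then show ?thesis
    using t ty uv w ne dist unfolding deg_new by (auto simp: add_mset_commute numeral_eq_Suc)
qed

lemma subdivide_and_hang_leaf:
  fixes G :: "nat sgraph"
  assumes G: "subcubic G" and t: "type_mset G = add_mset {i, j} N"
  shows "\<exists>H :: nat sgraph. subcubic H \<and> type_mset H = N + {#{i, 3}, {3, j}, {1, 3}#}"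
proof -
  have s: "simple_graph G" using G by (simp add: subcubic_def)
  obtain u v where uv: "{u, v} \<in> edges G" "u \<noteq> v" "u \<in> verts G" "v \<in> verts G"
    "vertex_degree G u = i" "vertex_degree G v = j" using edge_of_type[OF s t] by metis
  have ty: "edge_type G {u, v} = {i, j}" using uv by (simp add: edge_type_def)
  have "finite (verts G)" using s by (simp add: simple_graph_def)
  then obtain w z where w: "w \<notin> verts G" "z \<notin> verts G" "w \<noteq> z" by (rule fresh_vertices)
  have ne: "u \<noteq> w" "v \<noteq> w" "u \<noteq> z" "v \<noteq> z" using uv w by auto
  let ?E' = "{{u, w}, {w, v}, {z, w}}"
  have dist: "{u, w} \<noteq> {w, v}" "{u, w} \<noteq> {z, w}" "{w, v} \<noteq> {z, w}"
    using uv(2) ne w by (auto simp: doubleton_eq_iff)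
  have deg_new: "card {e \<in> ?E'. a \<in> e} = (if a \<in> {u, w} then 1 else 0) + (if a \<in> {w, v} then 1 else 0)
      + (if a \<in> {z, w} then 1 else 0)" for a
    by (subst card_incident_eq_sum) (use dist in simp_all)
  have deg_old: "card {e \<in> {{u, v}}. a \<in> e} = (if a \<in> {u, v} then 1 else 0)" for a
    by (subst card_incident_eq_sum) simp_all
  have "\<exists>H :: nat sgraph. subcubic H \<and>
    type_mset H = type_mset G - image_mset (edge_type G) (mset_set {{u, v}})
      + image_mset (\<lambda>e. (\<lambda>x. if x \<in> verts G then vertex_degree G x else card {e \<in> ?E'. x \<in> e}) ` e)
        (mset_set ?E')"
  proof (rule replace_edges[OF G, where W = "{w, z}"])
    show "(x, y) \<in> (adj ?E')\<^sup>*" if "{x, y} \<in> {{u, v}}" for x y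
      using that adj_edge2[of u w ?E' v] adj_edge2[of v w ?E' u] by (auto simp: doubleton_eq_iff insert_commute)
    show "\<exists>v\<in>verts G. (v, x) \<in> (adj ?E')\<^sup>*" if "x \<in> {w, z}" for x
      using that uv(3) adj_edge2[of u w ?E' z] adj_edge[of u w ?E'] by (auto simp: insert_commute)
    show "card {e \<in> ?E'. x \<in> e} = card {e \<in> {{u, v}}. x \<in> e}" if "x \<in> verts G" for x
    proof -
      have "x \<noteq> w" "x \<noteq> z" using that w by auto
      then show ?thesis using uv(2) unfolding deg_new deg_old by simp
    qed
    show "card {e \<in> ?E'. x \<in> e} \<le> 3" if "x \<in> {w, z}" for x
      using that ne w(3) unfolding deg_new by auto
  qed (use uv w ne in auto)
  then show ?thesis
    using t ty uv w ne dist unfolding deg_new by (auto simp: add_mset_commute numeral_eq_Suc)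
qed

text \<open>
  The two edges may share an endpoint, which is why degrees are computed as sums of indicators. Joining
  two new vertices raises the cyclomatic number by one and keeps a cubic graph cubic.
\<close>

lemma subdivide_two_edges_and_join:
  fixes G :: "nat sgraph"
  assumes G: "subcubic G" and t: "type_mset G = add_mset {3, 3} (add_mset {3, 3} N)"
  shows "\<exists>H :: nat sgraph. subcubic H \<and> type_mset H = N + replicate_mset 5 {3, 3}"
proof -
  have s: "simple_graph G" using G by (simp add: subcubic_def)
  have fE: "finite (edges G)" using finite_edges[OF s] .
  obtain u v where uv: "{u, v} \<in> edges G" "u \<noteq> v" "u \<in> verts G" "v \<in> verts G"
    "vertex_degree G u = 3" "vertex_degree G v = 3"
    and rest: "image_mset (edge_type G) (mset_set (edges G - {{u, v}})) = add_mset {3, 3} N"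
    using edge_of_type[OF s t] by metis
  have "{3, 3} \<in># image_mset (edge_type G) (mset_set (edges G - {{u, v}}))" using rest by simp
  then obtain f where f: "f \<in> edges G" "f \<noteq> {u, v}" "edge_type G f = {3, 3}"
    using fE by (auto simp del: insert_absorb2)
  obtain x y where xy: "f = {x, y}" "x \<noteq> y" "x \<in> verts G" "y \<in> verts G"
    using edge_endpoints[OF s f(1)] by metis
  have deg_xy: "vertex_degree G x = 3" "vertex_degree G y = 3"
    using f(3) xy(1) by (auto simp: edge_type_def)
  have ty: "edge_type G {u, v} = {3, 3}" "edge_type G {x, y} = {3, 3}"
    using uv deg_xy by (simp_all add: edge_type_def)
  have ef: "{u, v} \<noteq> {x, y}" using f xy by simp
  have "finite (verts G)" using s by (simp add: simple_graph_def)
  then obtain w z where w: "w \<notin> verts G" "z \<notin> verts G" "w \<noteq> z" by (rule fresh_vertices)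
  have ne: "u \<noteq> w" "v \<noteq> w" "u \<noteq> z" "v \<noteq> z" "x \<noteq> w" "y \<noteq> w" "x \<noteq> z" "y \<noteq> z"
    using uv xy w by auto
  let ?E' = "{{u, w}, {w, v}, {x, z}, {z, y}, {w, z}}"
  have dist: "{u, w} \<notin> {{w, v}, {x, z}, {z, y}, {w, z}}" "{w, v} \<notin> {{x, z}, {z, y}, {w, z}}"
    "{x, z} \<notin> {{z, y}, {w, z}}" "{z, y} \<notin> {{w, z}}"
    using uv(2) xy(2) ne w by (auto simp: doubleton_eq_iff)
  have deg_new: "card {e \<in> ?E'. a \<in> e} = (if a \<in> {u, w} then 1 else 0) + (if a \<in> {w, v} then 1 else 0)
     + (if a \<in> {x, z} then 1 else 0) + (if a \<in> {z, y} then 1 else 0) + (if a \<in> {w, z} then 1 else 0)" for a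
    by (subst card_incident_eq_sum) (use dist in simp_all)
  have deg_old: "card {e \<in> {{u, v}, {x, y}}. a \<in> e} = (if a \<in> {u, v} then 1 else 0)
     + (if a \<in> {x, y} then 1 else 0)" for a
    by (subst card_incident_eq_sum) (use ef in simp_all)
  have "\<exists>H :: nat sgraph. subcubic H \<and>
    type_mset H = type_mset G - image_mset (edge_type G) (mset_set {{u, v}, {x, y}})
      + image_mset (\<lambda>e. (\<lambda>x. if x \<in> verts G then vertex_degree G x else card {e \<in> ?E'. x \<in> e}) ` e)
        (mset_set ?E')"
  proof (rule replace_edges[OF G, where W = "{w, z}"])
    show "(a, b) \<in> (adj ?E')\<^sup>*" if "{a, b} \<in> {{u, v}, {x, y}}" for a b
    proof -
      have "(u, v) \<in> (adj ?E')\<^sup>*" "(x, y) \<in> (adj ?E')\<^sup>*"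
        by (rule adj_edge2[of u w ?E' v], simp, simp) (rule adj_edge2[of x z ?E' y], simp, simp)
      moreover from this(1) have "(v, u) \<in> (adj ?E')\<^sup>*" by (rule adj_rtrancl_sym)
      moreover from calculation(2) have "(y, x) \<in> (adj ?E')\<^sup>*" by (rule adj_rtrancl_sym)
      moreover have "(a = u \<and> b = v) \<or> (a = v \<and> b = u) \<or> (a = x \<and> b = y) \<or> (a = y \<and> b = x)"
        using that unfolding insert_iff doubleton_eq_iff by blast
      ultimately show ?thesis by (elim disjE conjE) (simp_all only:)
    qed
    show "\<exists>v\<in>verts G. (v, a) \<in> (adj ?E')\<^sup>*" if "a \<in> {w, z}" for a
      using that uv(3) xy(3) adj_edge[of u w ?E'] adj_edge[of x z ?E'] by blast
    show "card {e \<in> ?E'. a \<in> e} = card {e \<in> {{u, v}, {x, y}}. a \<in> e}" if "a \<in> verts G" for a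
    proof -
      have "a \<noteq> w" "a \<noteq> z" using that w by auto
      then show ?thesis using uv(2) xy(2) unfolding deg_new deg_old by simp
    qed
    show "card {e \<in> ?E'. a \<in> e} \<le> 3" if "a \<in> {w, z}" for a
      using that ne w(3) unfolding deg_new by auto
    show "{{u, v}, {x, y}} \<subseteq> edges G" using uv f xy by simp
    show "card e = 2 \<and> e \<subseteq> verts G \<union> {w, z} \<and> e \<inter> {w, z} \<noteq> {}" if "e \<in> ?E'" for e
      using that ne w(3) uv xy by auto
  qed (use w in auto)
  moreover have "image_mset (\<lambda>e. (\<lambda>x. if x \<in> verts G then vertex_degree G x else card {e \<in> ?E'. x \<in> e}) ` e)
        (mset_set ?E') = replicate_mset 5 {3, 3}"
    unfolding deg_new using dist ne w uv xy deg_xy by (simp add: numeral_eq_Suc)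
  moreover have "type_mset G - image_mset (edge_type G) (mset_set {{u, v}, {x, y}}) = N"
    using t ty ef by simp
  ultimately show ?thesis by simp
qed

section \<open>Small graphs and relabelling\<close>

definition list_degree :: "(nat \<times> nat) list \<Rightarrow> nat \<Rightarrow> nat" where
  "list_degree es v = length (filter (\<lambda>(a, b). a = v \<or> b = v) es)"

text \<open>
  Conditions that the simplifier can check on a concrete list. If every vertex except 0 has a smaller
  neighbour, descending along such neighbours leads to 0, so the graph is connected.
\<close>

lemma subcubic_from_edge_list:
  assumes "distinct es" "\<forall>(a, b)\<in>set es. a < b \<and> b < n" "3 \<le> n"
    and deg: "\<forall>v\<in>set [0..<n]. list_degree es v \<le> 3"
    and parent: "\<forall>v\<in>set [1..<n]. v \<in> snd ` set es"
  shows "\<exists>G :: nat sgraph. subcubic G \<and>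
    type_mset G = mset (map (\<lambda>(a, b). {list_degree es a, list_degree es b}) es)"
proof -
  let ?f = "\<lambda>(a, b). {a, b :: nat}"
  define G :: "nat sgraph" where "G = \<lparr>verts = {..<n}, edges = ?f ` set es\<rparr>"
  have inj: "inj_on ?f (set es)"
  proof (rule inj_onI)
    fix p q assume pq: "p \<in> set es" "q \<in> set es" "?f p = ?f q"
    have "fst p < snd p" "fst q < snd q" using assms(2) pq(1,2) by auto
    then show "p = q" using pq(3) by (auto simp: case_prod_unfold doubleton_eq_iff prod_eq_iff)
  qed
  have degree: "vertex_degree G v = list_degree es v" for v
  proof -
    have "{e \<in> edges G. v \<in> e} = ?f ` set (filter (\<lambda>(a, b). a = v \<or> b = v) es)"
      by (auto simp: G_def)
    then have "vertex_degree G v = card (set (filter (\<lambda>(a, b). a = v \<or> b = v) es))"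
      unfolding vertex_degree_def by (metis (lifting) card_image filter_is_subset inj inj_on_subset)
    then show ?thesis using assms(1) by (simp add: list_degree_def distinct_card del: set_filter)
  qed
  have simple: "simple_graph G" using assms(2) by (auto simp: simple_graph_def G_def)
  have root: "(0, v) \<in> (adj (edges G))\<^sup>*" if "v < n" for v
    using that
  proof (induction v rule: less_induct)
    case (less v)
    show ?case
    proof (cases "v = 0")
      case False
      then have "v \<in> set [1..<n]" using less.prems by auto
      then obtain u where u: "(u, v) \<in> set es" using parent by fastforce
      then have "u < v" using assms(2) by auto
      then have "(0, u) \<in> (adj (edges G))\<^sup>*" using less by simp
      moreover have "(u, v) \<in> adj (edges G)" using u by (force simp: G_def)
      ultimately show ?thesis by (rule rtrancl_into_rtrancl)
    qed simp
  qed
  have "connected_graph G"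
    unfolding connected_graph_def
  proof (intro ballI)
    fix u v assume "u \<in> verts G" "v \<in> verts G"
    then have "u < n" "v < n" by (simp_all add: G_def)
    show "(u, v) \<in> (adj (edges G))\<^sup>*"
      by (rule rtrancl_trans[OF adj_rtrancl_sym[OF root[OF \<open>u < n\<close>]] root[OF \<open>v < n\<close>]])
  qed
  moreover have "3 \<le> graph_order G" using assms(3) by (simp add: graph_order_def G_def)
  moreover have "\<forall>v\<in>verts G. vertex_degree G v \<le> 3" using deg degree by (simp add: G_def)
  ultimately have "subcubic G" using simple by (simp add: subcubic_def)
  moreover have "type_mset G = mset (map (\<lambda>(a, b). {list_degree es a, list_degree es b}) es)"
  proof -
    have "mset_set (edges G) = image_mset ?f (mset es)"
      using image_mset_mset_set[OF inj] mset_set_set[OF assms(1)] by (simp add: G_def)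
    then show ?thesis
      by (simp add: type_mset_def edge_type_def degree multiset.map_comp)
        (intro image_mset_cong, auto simp: edge_type_def degree)
  qed
  ultimately show ?thesis by blast
qed

text \<open>
  The constructions live on natural numbers, which always supply new vertices; the competitors of a
  given graph have to live on its own vertex type.
\<close>

lemma subcubic_relabel:
  fixes G :: "'a sgraph" and f :: "'a \<Rightarrow> 'b"
  assumes G: "subcubic G" and f: "inj_on f (verts G)"
  shows "\<exists>H :: 'b sgraph. subcubic H \<and> type_mset H = type_mset G"
proof -
  define H :: "'b sgraph" where "H = \<lparr>verts = f ` verts G, edges = image f ` edges G\<rparr>"
  have s: "simple_graph G" "connected_graph G" "\<And>v. v \<in> verts G \<Longrightarrow> vertex_degree G v \<le> 3"
      "3 \<le> card (verts G)"
    using G by (auto simp: subcubic_def graph_order_def)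
  have eV: "e \<subseteq> verts G" if "e \<in> edges G" for e using s(1) that by (simp add: simple_graph_def)
  have inj: "inj_on (image f) (edges G)"
    using eV f by (meson PowI inj_on_image_Pow inj_on_subset subsetI)
  have degree: "vertex_degree H (f v) = vertex_degree G v" if "v \<in> verts G" for v
  proof -
    have "{e \<in> edges H. f v \<in> e} = image f ` {e \<in> edges G. v \<in> e}"
    proof (intro equalityI subsetI)
      fix e' assume "e' \<in> {e \<in> edges H. f v \<in> e}"
      then obtain e where e: "e \<in> edges G" "e' = f ` e" "f v \<in> f ` e" by (auto simp: H_def)
      then have "v \<in> e" using inj_on_image_mem_iff[OF f that eV[OF e(1)]] by simp
      then show "e' \<in> image f ` {e \<in> edges G. v \<in> e}" using e by blast
    qed (auto simp: H_def)
    then show ?thesis unfolding vertex_degree_def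
      by (simp add: card_image inj_on_subset[OF inj])
  qed
  have "simple_graph H"
    using s(1) f by (auto simp: simple_graph_def H_def card_image inj_on_subset)
  moreover have "(f u, f v) \<in> (adj (edges H))\<^sup>*" if "(u, v) \<in> (adj (edges G))\<^sup>*" for u v
    using that
  proof (induction rule: rtrancl_induct)
    case (step y z)
    have "f ` {y, z} \<in> edges H" using step(2) unfolding H_def by (simp del: image_insert)
    then have "(f y, f z) \<in> adj (edges H)" by simp
    then show ?case using step(3) by (rule rtrancl_into_rtrancl[rotated])
  qed simp
  then have "connected_graph H"
    using s(2) by (auto simp: connected_graph_def H_def)
  moreover have "\<forall>v\<in>verts H. vertex_degree H v \<le> 3" using degree s(3) by (auto simp: H_def)
  moreover have "3 \<le> graph_order H" using s(4) card_image[OF f] by (simp add: graph_order_def H_def)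
  ultimately have "subcubic H" by (simp add: subcubic_def)
  moreover have "edge_type H (f ` e) = edge_type G e" if "e \<in> edges G" for e
    unfolding edge_type_def image_image using degree eV[OF that] by (intro image_cong) auto
  then have "type_mset H = type_mset G"
    using finite_edges[OF s(1)] unfolding type_mset_def
    by (simp add: H_def image_mset_mset_set[OF inj, symmetric] multiset.map_comp)
      (intro image_mset_cong, simp)
  ultimately show ?thesis by blast
qed

section \<open>Realizable edge vectors\<close>

definition vector_mset :: "nat \<Rightarrow> nat \<Rightarrow> nat \<Rightarrow> nat \<Rightarrow> nat \<Rightarrow> nat set multiset" where
  "vector_mset a b c d e = replicate_mset a {1, 2} + replicate_mset b {1, 3} + replicate_mset c {2, 2}
     + replicate_mset d {2, 3} + replicate_mset e {3, 3}"

text \<open>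
  By the counting identities the edge vector determines order and size.
\<close>

definition realizable :: "nat \<Rightarrow> nat \<Rightarrow> nat \<Rightarrow> nat \<Rightarrow> nat \<Rightarrow> bool" where
  "realizable a b c d e \<longleftrightarrow>
     (\<exists>G :: nat sgraph. subcubic G \<and> type_mset G = vector_mset a b c d e)"

lemma realizable_subdivide_33: "realizable a b c d (Suc e) \<Longrightarrow> realizable a b c (d + 2) e"
  unfolding realizable_def
  by (elim exE conjE, drule subdivide[where i = 3 and j = 3 and N = "vector_mset a b c d e"])
    (auto simp: vector_mset_def insert_commute numeral_eq_Suc)

lemma realizable_subdivide_13: "realizable a (Suc b) c d e \<Longrightarrow> realizable (Suc a) b c (Suc d) e"
  unfolding realizable_def
  by (elim exE conjE, drule subdivide[where i = 1 and j = 3 and N = "vector_mset a b c d e"])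
    (auto simp: vector_mset_def)

lemma realizable_subdivide_12: "realizable (Suc a) b c d e \<Longrightarrow> realizable (Suc a) b (Suc c) d e"
  unfolding realizable_def
  by (elim exE conjE, drule subdivide[where i = 1 and j = 2 and N = "vector_mset a b c d e"])
    (auto simp: vector_mset_def)

lemma realizable_hang_13: "realizable a (Suc b) c d e \<Longrightarrow> realizable a (Suc (Suc b)) c d (Suc e)"
  unfolding realizable_def
  by (elim exE conjE, drule subdivide_and_hang_leaf[where i = 1 and j = 3 and N = "vector_mset a b c d e"])
    (auto simp: vector_mset_def)

lemma realizable_hang_33: "realizable a b c d (Suc e) \<Longrightarrow> realizable a (Suc b) c d (Suc (Suc e))"
  unfolding realizable_def
  by (elim exE conjE, drule subdivide_and_hang_leaf[where i = 3 and j = 3 and N = "vector_mset a b c d e"])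
    (auto simp: vector_mset_def)

lemma realizable_join: "realizable a b c d (e + 2) \<Longrightarrow> realizable a b c d (e + 5)"
  unfolding realizable_def
  by (elim exE conjE, drule subdivide_two_edges_and_join[where N = "vector_mset a b c d e"])
    (auto simp: vector_mset_def numeral_eq_Suc)

lemma realizable_from_edge_list:
  assumes "distinct es" "\<forall>(a, b)\<in>set es. a < b \<and> b < n" "3 \<le> n"
    "\<forall>v\<in>set [0..<n]. list_degree es v \<le> 3" "\<forall>v\<in>set [1..<n]. v \<in> snd ` set es"
    "mset (map (\<lambda>(a, b). {list_degree es a, list_degree es b}) es) = vector_mset a b c d e"
  shows "realizable a b c d e"
  using subcubic_from_edge_list[OF assms(1-5)] assms(6) by (simp add: realizable_def)

text \<open>
  The starting graphs. The first four have cubic vertices and otherwise only leaves and are the smallest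
  such graphs of cyclomatic number 0, 1, 2 and 3. The other two provide the small vectors that no
  subdivision of a simple graph with only leaves and cubic vertices realizes.
\<close>

lemma star_realizable: "realizable 0 3 0 0 0"
  by (rule realizable_from_edge_list[where es = "[(0,1), (0,2), (0,3)]" and n = 4])
    (simp_all add: list_degree_def vector_mset_def numeral_eq_Suc insert_commute)

lemma net_realizable: "realizable 0 3 0 0 3"
  by (rule realizable_from_edge_list[where es = "[(0,1), (0,2), (1,2), (0,3), (1,4), (2,5)]" and n = 6])
    (simp_all add: list_degree_def vector_mset_def numeral_eq_Suc insert_commute)

lemma diamond_with_two_leaves_realizable: "realizable 0 2 0 0 5"
  by (rule realizable_from_edge_list[where es = "[(0,1), (0,2), (1,2), (0,3), (1,3), (2,4), (3,5)]" and n = 6])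
    (simp_all add: list_degree_def vector_mset_def numeral_eq_Suc insert_commute)

lemma K4_realizable: "realizable 0 0 0 0 6"
  by (rule realizable_from_edge_list[where es = "[(0,1), (0,2), (1,2), (0,3), (1,3), (2,3)]" and n = 4])
    (simp_all add: list_degree_def vector_mset_def numeral_eq_Suc insert_commute)

lemma bull_realizable: "realizable 0 2 0 2 1"
  by (rule realizable_from_edge_list[where es = "[(0,1), (0,2), (1,2), (0,3), (1,4)]" and n = 5])
    (simp_all add: list_degree_def vector_mset_def numeral_eq_Suc insert_commute)

lemma diamond_with_one_leaf_realizable: "realizable 0 1 0 2 3"
  by (rule realizable_from_edge_list[where es = "[(0,1), (0,2), (1,2), (0,3), (1,3), (2,4)]" and n = 5])
    (simp_all add: list_degree_def vector_mset_def numeral_eq_Suc insert_commute)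

lemma add_leaves:
  assumes "realizable 0 p 0 0 e" "0 < p \<or> 0 < e"
  shows "realizable 0 (p + k) 0 0 (e + k)"
proof (induction k)
  case (Suc k)
  show ?case
  proof (cases "p + k")
    case 0
    then obtain e' where "e + k = Suc e'" using assms(2) by (cases e) auto
    then show ?thesis using realizable_hang_33[of 0 "p + k" 0 0 e'] Suc by simp
  next
    case (Suc p')
    then show ?thesis using realizable_hang_13[of 0 p' 0 0 "e + k"] Suc.IH by simp
  qed
qed (use assms in simp)

lemma cubic_realizable: "realizable 0 0 0 0 (3 * k + 6)"
proof (induction k)
  case (Suc k)
  then show ?case using realizable_join[of 0 0 0 0 "3 * k + 4"] by (simp add: algebra_simps)
qed (simp add: K4_realizable)

text \<open>
  Here p is the number of leaves and q is size minus order, that is, the cyclomatic number minus one.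
  A connected graph of leaves and cubic vertices, other than a single edge, has p + 3q edges of type
  (3,3). The
  lower bounds on p say that there is a cubic vertex if q = -1, and at least three or four of them if
  q = 0 or q = 1: fewer vertices carry no cycle, respectively no two independent cycles.
\<close>

lemma core_realizable:
  fixes p q :: int
  assumes "-1 \<le> q" "q \<le> 0 \<Longrightarrow> 3 \<le> p" "q = 1 \<Longrightarrow> 2 \<le> p" "0 \<le> p"
  shows "realizable 0 (nat p) 0 0 (nat (p + 3 * q))"
proof -
  consider "q = -1" | "q = 0" | "q = 1" | "2 \<le> q" using assms(1) by linarith
  then show ?thesis
  proof cases
    case 1
    then have "nat p = 3 + nat (p - 3)" "nat (p + 3 * q) = 0 + nat (p - 3)" using assms(2) by linarith+
    then show ?thesis using add_leaves[OF star_realizable, of "nat (p - 3)"] by simp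
  next
    case 2
    then have "nat p = 3 + nat (p - 3)" "nat (p + 3 * q) = 3 + nat (p - 3)" using assms(2) by linarith+
    then show ?thesis using add_leaves[OF net_realizable, of "nat (p - 3)"] by simp
  next
    case 3
    then have "nat p = 2 + nat (p - 2)" "nat (p + 3 * q) = 5 + nat (p - 2)" using assms(3) by linarith+
    then show ?thesis using add_leaves[OF diamond_with_two_leaves_realizable, of "nat (p - 2)"] by simp
  next
    case 4
    then have "nat (p + 3 * q) = (3 * nat (q - 2) + 6) + nat p" using assms(4) by linarith
    then show ?thesis using add_leaves[OF cubic_realizable, of "nat (q - 2)" "nat p"] by simp
  qed
qed

lemma subdivide_all_13: "realizable a (b + k) c d e \<Longrightarrow> realizable (a + k) b c (d + k) e"
proof (induction k arbitrary: a d)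
  case (Suc k)
  then show ?case using Suc.IH[of "Suc a" "Suc d"] realizable_subdivide_13[of a "b + k" c d e] by simp
qed simp

lemma lengthen_pendant_path: "realizable a b c d e \<Longrightarrow> 0 < a \<Longrightarrow> realizable a b (c + k) d e"
proof (induction k)
  case (Suc k)
  then show ?case using realizable_subdivide_12[of "a - 1" b "c + k" d e] by simp
qed simp

lemma subdivide_some_33: "realizable a b c d (e + k) \<Longrightarrow> realizable a b c (d + 2 * k) e"
proof (induction k arbitrary: d)
  case (Suc k)
  then show ?case using Suc.IH[of "d + 2"] realizable_subdivide_33[of a b c d "e + k"] by simp
qed simp

lemma edge_count_of_vector_mset:
  assumes "simple_graph G" "type_mset G = vector_mset a b c d e"
  shows "edge_count G 1 2 = a" "edge_count G 1 3 = b" "edge_count G 2 2 = c"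
    "edge_count G 2 3 = d" "edge_count G 3 3 = e"
  using assms by (simp_all add: edge_count_eq_count vector_mset_def doubleton_eq_iff)

definition realizable_vector :: "int \<times> int \<times> int \<times> int \<times> int \<Rightarrow> bool" where
  "realizable_vector = (\<lambda>(a, b, c, d, e). 0 \<le> a \<and> 0 \<le> b \<and> 0 \<le> c \<and> 0 \<le> d \<and> 0 \<le> e \<and>
     realizable (nat a) (nat b) (nat c) (nat d) (nat e))"

text \<open>
  By the counting identities every graph that realizes the vector has the order and size of the given
  graph, so its vertices can be renamed to those of the given graph.
\<close>

lemma chemical_graph_with_vector:
  fixes G :: "'a sgraph"
  assumes G: "chemical_graph G" and r: "realizable_vector (a, b, c, d, e)"
    and order: "9 * a + 8 * b + 6 * c + 5 * d + 4 * e = 6 * int (graph_order G)"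
    and size: "a + b + c + d + e = int (graph_size G)"
  obtains H :: "'a sgraph" where "chemical_graph H" "graph_order H = graph_order G"
    "graph_size H = graph_size G" "edge_vector H = (a, b, c, d, e)"
proof -
  have nonneg: "0 \<le> a" "0 \<le> b" "0 \<le> c" "0 \<le> d" "0 \<le> e"
    using r by (auto simp: realizable_vector_def)
  obtain K :: "nat sgraph" where K: "subcubic K"
      "type_mset K = vector_mset (nat a) (nat b) (nat c) (nat d) (nat e)"
    using r by (auto simp: realizable_vector_def realizable_def)
  have sK: "simple_graph K" using K(1) by (simp add: subcubic_def)
  note cK = edge_count_of_vector_mset[OF sK K(2)]
  have "int (6 * graph_order K) = 6 * int (graph_order G)"
    using nonneg unfolding order_eq_weighted_edge_counts[OF K(1)] cK order[symmetric] by simp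
  then have nK: "card (verts K) = card (verts G)" by (simp add: graph_order_def)
  have "finite (verts K)" "finite (verts G)"
    using sK G by (simp_all add: chemical_graph_def simple_graph_def)
  then obtain f where f: "inj_on f (verts K)" "f ` verts K = verts G"
    using nK finite_same_card_bij by (metis bij_betw_def)
  then obtain H :: "'a sgraph" where H: "subcubic H" "type_mset H = type_mset K"
    using subcubic_relabel[OF K(1) f(1)] by blast
  have sH: "simple_graph H" using H(1) by (simp add: subcubic_def)
  note cH = edge_count_of_vector_mset[OF sH H(2)[unfolded K(2)]]
  have "int (6 * graph_order H) = 6 * int (graph_order G)"
    using nonneg unfolding order_eq_weighted_edge_counts[OF H(1)] cH order[symmetric] by simp
  then have oH: "graph_order H = graph_order G" by simp
  have "int (graph_size H) = int (graph_size G)"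
    using nonneg unfolding size_eq_sum_edge_counts[OF H(1)] cH size[symmetric] by simp
  then have zH: "graph_size H = graph_size G" by simp
  have "chemical_graph H" using G H(1) oH zH by (simp add: chemical_graph_def subcubic_def)
  moreover have "edge_vector H = (a, b, c, d, e)" using nonneg unfolding edge_vector_def cH by simp
  ultimately show ?thesis using that oH zH by blast
qed

section \<open>The ABC index as a function of two edge counts\<close>

text \<open>
  The part of the ABC index that varies among graphs of the same size.
\<close>

definition score :: "int \<times> int \<times> int \<times> int \<times> int \<Rightarrow> real" where
  "score = (\<lambda>(a, b, c, d, e). (sqrt (2/3) - sqrt (1/2)) * real_of_int b - (sqrt (1/2) - 2/3) * real_of_int e)"

lemma score_coefficients:
  shows "0 < sqrt (1/2) - 2/3"
    and "2 * (sqrt (1/2) - 2/3) < sqrt (2/3) - sqrt (1/2)"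
    and "sqrt (2/3) - sqrt (1/2) < 3 * (sqrt (1/2) - 2/3)"
proof -
  have "7071/10000 < sqrt (1/2)" by (rule real_less_rsqrt) (simp add: power2_eq_square)
  moreover have "sqrt (1/2) < 7072/10000" by (rule real_less_lsqrt) (simp_all add: power2_eq_square)
  moreover have "816/1000 < sqrt (2/3)" by (rule real_less_rsqrt) (simp add: power2_eq_square)
  moreover have "sqrt (2/3) < 8167/10000" by (rule real_less_lsqrt) (simp_all add: power2_eq_square)
  ultimately show "0 < sqrt (1/2) - 2/3" "2 * (sqrt (1/2) - 2/3) < sqrt (2/3) - sqrt (1/2)"
    "sqrt (2/3) - sqrt (1/2) < 3 * (sqrt (1/2) - 2/3)" by argo+
qed

lemma ABC_eq_score:
  assumes "subcubic G"
  shows "ABC G = sqrt (1/2) * real (graph_size G) + score (edge_vector G)"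
proof -
  have "sqrt (4 / 9) = 2 / (3 :: real)" by (rule real_sqrt_unique) (simp_all add: power2_eq_square)
  then have "ABC G = sqrt (1/2) * real (edge_count G 1 2) + sqrt (2/3) * real (edge_count G 1 3)
      + sqrt (1/2) * real (edge_count G 2 2) + sqrt (1/2) * real (edge_count G 2 3)
      + 2/3 * real (edge_count G 3 3)"
    by (simp add: ABC_def degree_based_index_def)
  then show ?thesis
    by (simp add: size_eq_sum_edge_counts[OF assms] score_def edge_vector_def algebra_simps)
qed

text \<open>
  For the maximum. Here s stands for 4a + c. Along the counting identity the score changes by
  -(3\<beta> - \<alpha>)(b - b') - \<beta> s, so it can only fail to drop if b < b'. But then s is less than
  b' - b because 3\<beta> - \<alpha> < \<beta>, and e would be smaller than e' - 2(b' - b), hence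
  negative as e' \<le> 2.
\<close>

lemma score_ge_imp_same_leaf_count:
  fixes b e b' e' :: int
  assumes ge: "score (a', b', c', d', e') \<le> score (a, b, c, d, e)"
    and s: "0 \<le> s" "e - e' = 3 * (b - b') + s" and e: "0 \<le> e" "e' \<le> 2 \<or> b' \<le> b"
  shows "b = b' \<and> s = 0"
proof -
  define \<alpha> \<beta> where "\<alpha> = sqrt (2/3) - sqrt (1/2)" and "\<beta> = sqrt (1/2) - 2/3"
  have ab: "0 < \<beta>" "2 * \<beta> < \<alpha>" "\<alpha> < 3 * \<beta>" unfolding \<alpha>_def \<beta>_def by (rule score_coefficients)+
  have "\<beta> * (e - e') \<le> \<alpha> * (b - b')"
    using ge unfolding score_def \<alpha>_def[symmetric] \<beta>_def[symmetric] by (simp add: algebra_simps)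
  then have main: "(3 * \<beta> - \<alpha>) * (b - b') + \<beta> * s \<le> 0" unfolding s(2) by (simp add: algebra_simps)
  show ?thesis
  proof (cases "b' \<le> b")
    case True
    then have "0 \<le> (3 * \<beta> - \<alpha>) * (b - b')" "0 \<le> \<beta> * s" using ab s(1) by simp_all
    then have "(3 * \<beta> - \<alpha>) * (b - b') = 0" "\<beta> * s = 0" using main by linarith+
    then show ?thesis using ab by simp
  next
    case False
    then have "(3 * \<beta> - \<alpha>) * (b' - b) < \<beta> * (b' - b)" using ab by simp
    then have "\<beta> * s < \<beta> * (b' - b)" using main by (simp add: algebra_simps)
    then have "s < b' - b" using ab(1) by simp
    moreover have "e' \<le> 2" using e(2) False by simp
    ultimately have False using False e(1) s by presburger
    then show ?thesis ..
  qed
qed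

text \<open>
  For the minimum. A leaf costs \<alpha> > 2\<beta> and must be paid for by more than two additional
  (3,3)-edges.
\<close>

lemma score_le_imp_more_33_edges:
  fixes b e e' :: int
  assumes le: "score (a, b, c, d, e) \<le> score (a', 0, c', d', e')" and b: "0 \<le> b"
  shows "e' + 2 * b \<le> e \<and> (0 < b \<longrightarrow> e' + 2 * b < e)"
proof -
  define \<alpha> \<beta> where "\<alpha> = sqrt (2/3) - sqrt (1/2)" and "\<beta> = sqrt (1/2) - 2/3"
  have ab: "0 < \<beta>" "2 * \<beta> < \<alpha>" unfolding \<alpha>_def \<beta>_def by (rule score_coefficients)+
  have le': "\<alpha> * b \<le> \<beta> * (e - e')"
    using le unfolding score_def \<alpha>_def[symmetric] \<beta>_def[symmetric] by (simp add: algebra_simps)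
  show ?thesis
  proof (cases "b = 0")
    case True
    then show ?thesis using le' ab by (simp add: zero_le_mult_iff)
  next
    case False
    then have "2 * \<beta> * b < \<alpha> * b" using ab b by simp
    then have "\<beta> * (2 * b) < \<beta> * (e - e')" using le' by (simp add: algebra_simps)
    then have "2 * b < e - e'" using ab(1) by simp
    then show ?thesis by linarith
  qed
qed

definition admissible :: "int \<Rightarrow> int \<Rightarrow> bool" where
  "admissible n m \<longleftrightarrow> 7 \<le> n \<and> n - 1 \<le> m \<and> 2 * m \<le> 3 * n - 3"

definition has_order_and_size :: "int \<Rightarrow> int \<Rightarrow> int \<times> int \<times> int \<times> int \<times> int \<Rightarrow> bool" where
  "has_order_and_size n m = (\<lambda>(a, b, c, d, e). 9 * a + 8 * b + 6 * c + 5 * d + 4 * e = 6 * n \<and> a + b + c + d + e = m)"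

lemma chemical_admissible:
  assumes "chemical_graph G"
  shows "admissible (int (graph_order G)) (int (graph_size G))"
  using assms size_ge_order_minus_one[OF chemical_imp_subcubic[OF assms]]
  by (auto simp: chemical_graph_def admissible_def field_simps)

text \<open>
  All that the extremal argument uses about a graph: its two counting identities, the bound from pendant
  paths (the alternative being a graph without cubic vertices), and a bound on the (3,3)-edges that the
  k cubic vertices can span.
\<close>

lemma chemical_vector:
  assumes "chemical_graph G" "edge_vector G = (a, b, c, d, e)"
  shows "0 \<le> a" "0 \<le> b" "0 \<le> c" "0 \<le> d" "0 \<le> e"
    and "has_order_and_size (int (graph_order G)) (int (graph_size G)) (a, b, c, d, e)"
    and "a \<le> d \<or> (b = 0 \<and> d = 0 \<and> e = 0)"
    and "\<exists>k. 3 * k = b + d + 2 * e \<and> 2 * e \<le> k * (k - 1)"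
proof -
  have G: "subcubic G" using chemical_imp_subcubic[OF assms(1)] .
  have v: "a = int (edge_count G 1 2)" "b = int (edge_count G 1 3)" "c = int (edge_count G 2 2)"
    "d = int (edge_count G 2 3)" "e = int (edge_count G 3 3)"
    using assms(2) by (auto simp: edge_vector_def)
  show "0 \<le> a" "0 \<le> b" "0 \<le> c" "0 \<le> d" "0 \<le> e" using v by simp_all
  show "has_order_and_size (int (graph_order G)) (int (graph_size G)) (a, b, c, d, e)"
    using arg_cong[OF order_eq_weighted_edge_counts[OF G], of int] size_eq_sum_edge_counts[OF G]
    unfolding has_order_and_size_def v by simp
  let ?k = "card {v \<in> verts G. vertex_degree G v = 3}"
  have k: "3 * int ?k = b + d + 2 * e"
    using arg_cong[OF three_times_cubic_vertices[OF G], of int] unfolding v by simp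
  show "a \<le> d \<or> (b = 0 \<and> d = 0 \<and> e = 0)"
  proof (cases "\<exists>x\<in>verts G. vertex_degree G x = 3")
    case True
    then show ?thesis using pendant_paths_end_at_cubic_vertices[OF G] v by auto
  next
    case False
    then have "{v \<in> verts G. vertex_degree G v = 3} = {}" by blast
    then have "?k = 0" by (simp only: card.empty)
    then have "b + d + 2 * e = 0" using k by linarith
    then show ?thesis using v by linarith
  qed
  have "edge_count G 3 3 \<le> ?k * (?k - 1) div 2"
    using edge_count_33_le[OF G] by (simp add: choose_two)
  then have "2 * edge_count G 3 3 \<le> ?k * (?k - 1)" by linarith
  then have "2 * e \<le> int (?k * (?k - 1))" unfolding v by linarith
  also have "\<dots> = int ?k * (int ?k - 1)" by (cases ?k) (simp_all add: algebra_simps)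
  finally show "\<exists>k. 3 * k = b + d + 2 * e \<and> 2 * e \<le> k * (k - 1)" using k by blast
qed

section \<open>The maximum\<close>

lemma of_int_bounds:
  shows "real_of_int m \<le> (6 * real_of_int n + 2) / 5 \<longleftrightarrow> 5 * m \<le> 6 * n + 2"
    and "(6 * real_of_int n + 3) / 5 \<le> real_of_int m \<longleftrightarrow> 6 * n + 3 \<le> 5 * m"
    and "real_of_int m \<le> (3 * real_of_int n - 3) / 2 \<longleftrightarrow> 2 * m \<le> 3 * n - 3"
proof -
  have "real_of_int (5 * m) \<le> real_of_int (6 * n + 2) \<longleftrightarrow> 5 * m \<le> 6 * n + 2"
    "real_of_int (6 * n + 3) \<le> real_of_int (5 * m) \<longleftrightarrow> 6 * n + 3 \<le> 5 * m"
    "real_of_int (2 * m) \<le> real_of_int (3 * n - 3) \<longleftrightarrow> 2 * m \<le> 3 * n - 3"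
    by (rule of_int_le_iff)+
  then show "real_of_int m \<le> (6 * real_of_int n + 2) / 5 \<longleftrightarrow> 5 * m \<le> 6 * n + 2"
    "(6 * real_of_int n + 3) / 5 \<le> real_of_int m \<longleftrightarrow> 6 * n + 3 \<le> 5 * m"
    "real_of_int m \<le> (3 * real_of_int n - 3) / 2 \<longleftrightarrow> 2 * m \<le> 3 * n - 3"
    unfolding of_int_mult of_int_add of_int_diff of_int_numeral
    by (simp_all only: le_divide_eq_numeral1 divide_le_eq_numeral1 mult.commute)
qed

text \<open>
  Writing 2m = 3s + r turns the divisions in the definition into linear expressions.
\<close>

lemma F9_vectors_cases:
  assumes y: "y \<in> F9_vectors n m"
  obtains (leaves) s r where "0 \<le> r" "r \<le> 2" "2 * m = 3 * s + r" "5 * m \<le> 6 * n + 2"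
      "y = (0, 2 * n - m - s, 0, 4 * s - 2 * n, r)"
  | (no_leaves) "6 * n + 3 \<le> 5 * m" "y = (0, 0, 0, 6 * n - 4 * m, 5 * m - 6 * n)"
proof -
  define s r where "s = (2 * m) div 3" and "r = (2 * m) mod 3"
  have sr: "0 \<le> r" "r \<le> 2" "2 * m = 3 * s + r" unfolding s_def r_def by presburger+
  have div: "(6 * n - 5 * m + r) div 3 = 2 * n - m - s" "(8 * m - 6 * n - 4 * r) div 3 = 4 * s - 2 * n"
    using sr(3) by presburger+
  show ?thesis
    using y leaves[OF sr] no_leaves unfolding F9_vectors_def of_int_bounds r_def[symmetric] div by auto
qed

lemma F9_vector_leaves_mem:
  assumes "n - 1 \<le> m" "5 * m \<le> 6 * n + 2" "0 \<le> r" "r \<le> 2" "2 * m = 3 * s + r"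
  shows "(0, 2 * n - m - s, 0, 4 * s - 2 * n, r) \<in> F9_vectors n m"
proof -
  have r: "(2 * m) mod 3 = r" using assms(3-5) by presburger
  have div: "(6 * n - 5 * m + r) div 3 = 2 * n - m - s" "(8 * m - 6 * n - 4 * r) div 3 = 4 * s - 2 * n"
    using assms(5) by presburger+
  show ?thesis using assms(1,2) unfolding F9_vectors_def of_int_bounds r div by simp
qed

text \<open>
  Take a graph with p leaves and otherwise cubic vertices and subdivide all but r, respectively
  5m - 6n, of its (3,3)-edges. For m = n + 1 \<le> 9 there is only one leaf, and a simple graph of this kind
  does not exist; there a diamond (the complete graph on four vertices minus an edge) with a leaf at one of
  its two vertices of degree 2 takes over, the other one counting as the midpoint of an edge that has
  already been subdivided.
\<close>

lemma F9_vector_realizable: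
  assumes "admissible n m"
  shows "\<exists>y\<in>F9_vectors n m. realizable_vector y \<and> has_order_and_size n m y"
proof (cases "5 * m \<le> 6 * n + 2")
  case True
  define s r where "s = (2 * m) div 3" and "r = (2 * m) mod 3"
  have sr: "0 \<le> r" "r \<le> 2" "2 * m = 3 * s + r" unfolding s_def r_def by presburger+
  have nm: "7 \<le> n" "n - 1 \<le> m" "2 * m \<le> 3 * n - 3" using assms by (simp_all add: admissible_def)
  let ?p = "2 * n - m - s" and ?k = "2 * s - n"
  have p: "0 \<le> ?p" using True sr by linarith
  have k: "0 \<le> ?k" using sr nm by linarith
  have "realizable 0 (nat ?p) 0 (2 * nat ?k) (nat r)"
  proof (cases "m = n + 1 \<and> n \<le> 8")
    case True
    then consider "n = 7" "m = 8" | "n = 8" "m = 9" using nm(1) by linarith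
    then show ?thesis
    proof cases
      case 1
      then have "s = 5" "r = 1" using sr by presburger+
      then show ?thesis using 1 subdivide_some_33[of 0 1 0 2 1 2] diamond_with_one_leaf_realizable
        by (simp add: numeral_eq_Suc)
    next
      case 2
      then have "s = 6" "r = 0" using sr by presburger+
      then show ?thesis using 2 subdivide_some_33[of 0 1 0 2 0 3] diamond_with_one_leaf_realizable
        by (simp add: numeral_eq_Suc)
    qed
  next
    case False
    have "?p + 3 * (m - n) = r + ?k" using sr by presburger
    then have "nat (?p + 3 * (m - n)) = nat r + nat ?k" using sr k by (simp add: nat_add_distrib)
    moreover have "realizable 0 (nat ?p) 0 0 (nat (?p + 3 * (m - n)))"
    proof (rule core_realizable)
      show "3 \<le> ?p" if "m - n \<le> 0" using that nm sr by linarith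
      show "2 \<le> ?p" if "m - n = 1"
      proof -
        have "m = n + 1" "9 \<le> n" using that False by auto
        then show ?thesis using sr by linarith
      qed
    qed (use nm p in linarith)+
    ultimately show ?thesis using subdivide_some_33[of 0 "nat ?p" 0 0 "nat r" "nat ?k"] by simp
  qed
  moreover have "nat (4 * s - 2 * n) = 2 * nat ?k" using k by linarith
  ultimately have "realizable_vector (0, ?p, 0, 4 * s - 2 * n, r)"
    using p k sr(1) by (simp add: realizable_vector_def)
  moreover have "has_order_and_size n m (0, ?p, 0, 4 * s - 2 * n, r)"
    unfolding has_order_and_size_def prod.case using sr(3) by presburger
  ultimately show ?thesis using F9_vector_leaves_mem[OF nm(2) True sr] by blast
next
  case False
  have nm: "7 \<le> n" "2 * m \<le> 3 * n - 3" using assms by (simp_all add: admissible_def)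
  have "(0, 0, 0, 6 * n - 4 * m, 5 * m - 6 * n) \<in> F9_vectors n m"
    using False nm unfolding F9_vectors_def of_int_bounds by simp
  moreover have "realizable_vector (0, 0, 0, 6 * n - 4 * m, 5 * m - 6 * n)"
  proof -
    have "realizable 0 0 0 0 (nat (0 + 3 * (m - n)))"
      using core_realizable[of "m - n" 0] False nm by simp
    moreover have "0 + 3 * (m - n) = (5 * m - 6 * n) + (3 * n - 2 * m)" by simp
    then have "nat (0 + 3 * (m - n)) = nat (5 * m - 6 * n) + nat (3 * n - 2 * m)"
      using False nm by (simp only: nat_add_distrib)
    moreover have "nat (6 * n - 4 * m) = 2 * nat (3 * n - 2 * m)" using nm by linarith
    ultimately have "realizable 0 0 0 (nat (6 * n - 4 * m)) (nat (5 * m - 6 * n))"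
      using subdivide_some_33[of 0 0 0 0 "nat (5 * m - 6 * n)" "nat (3 * n - 2 * m)"] by simp
    then show ?thesis using False nm by (simp add: realizable_vector_def)
  qed
  moreover have "has_order_and_size n m (0, 0, 0, 6 * n - 4 * m, 5 * m - 6 * n)"
    unfolding has_order_and_size_def by simp
  ultimately show ?thesis by blast
qed

lemma score_ge_F9_imp_eq:
  assumes G: "chemical_graph G"
    and y: "y \<in> F9_vectors (int (graph_order G)) (int (graph_size G))"
    and ge: "score y \<le> score (edge_vector G)"
  shows "edge_vector G = y"
proof -
  define n m where "n = int (graph_order G)" and "m = int (graph_size G)"
  obtain a b c d e where v: "edge_vector G = (a, b, c, d, e)" by (metis surj_pair)
  note cv = chemical_vector[OF G v, folded n_def m_def]
  have eqs: "9 * a + 8 * b + 6 * c + 5 * d + 4 * e = 6 * n" "a + b + c + d + e = m"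
    using cv(6) by (auto simp: has_order_and_size_def)
  from y[folded n_def m_def] show ?thesis
  proof (cases rule: F9_vectors_cases)
    case (leaves s r)
    have "b = 2 * n - m - s \<and> 4 * a + c = 0"
    proof (rule score_ge_imp_same_leaf_count)
      show "score (0, 2 * n - m - s, 0, 4 * s - 2 * n, r) \<le> score (a, b, c, d, e)"
        using ge v leaves(5) by simp
      show "e - r = 3 * (b - (2 * n - m - s)) + (4 * a + c)" using eqs leaves(3) by algebra
    qed (use cv(1-5) leaves(1,2) in simp_all)
    moreover from this have "a = 0" "c = 0" using cv(1-5) by linarith+
    ultimately show ?thesis using eqs leaves(3) unfolding v leaves(5) by simp
  next
    case no_leaves
    have "b = 0 \<and> 4 * a + c = 0"
    proof (rule score_ge_imp_same_leaf_count)
      show "score (0, 0, 0, 6 * n - 4 * m, 5 * m - 6 * n) \<le> score (a, b, c, d, e)"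
        using ge v no_leaves(2) by simp
      show "e - (5 * m - 6 * n) = 3 * (b - 0) + (4 * a + c)" using eqs by algebra
    qed (use cv(1-5) in simp_all)
    moreover from this have "a = 0" "c = 0" using cv(1-5) by linarith+
    ultimately show ?thesis using eqs unfolding v no_leaves(2) by simp
  qed
qed

lemma maximizes_ABC_iff:
  fixes G :: "'a sgraph"
  assumes G: "chemical_graph G"
  shows "maximizes ABC G \<longleftrightarrow> edge_vector G \<in> F9_vectors (int (graph_order G)) (int (graph_size G))"
proof
  assume max: "maximizes ABC G"
  obtain y where y: "y \<in> F9_vectors (int (graph_order G)) (int (graph_size G))" "realizable_vector y"
      "has_order_and_size (int (graph_order G)) (int (graph_size G)) y"
    using F9_vector_realizable[OF chemical_admissible[OF G]] by blast
  obtain a b c d e where v: "y = (a, b, c, d, e)" by (metis surj_pair)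
  obtain H :: "'a sgraph" where H: "chemical_graph H" "graph_order H = graph_order G"
      "graph_size H = graph_size G" "edge_vector H = y"
    using chemical_graph_with_vector[OF G y(2)[unfolded v]] y(3) unfolding v has_order_and_size_def by auto
  have "ABC H \<le> ABC G" using max H unfolding maximizes_def by blast
  then have "score y \<le> score (edge_vector G)"
    using H by (simp add: ABC_eq_score chemical_imp_subcubic G)
  then show "edge_vector G \<in> F9_vectors (int (graph_order G)) (int (graph_size G))"
    using score_ge_F9_imp_eq[OF G y(1)] y(1) by simp
next
  assume y: "edge_vector G \<in> F9_vectors (int (graph_order G)) (int (graph_size G))"
  show "maximizes ABC G"
    unfolding maximizes_def
  proof (intro allI impI)
    fix H :: "'a sgraph"
    assume H: "chemical_graph H \<and> graph_order H = graph_order G \<and> graph_size H = graph_size G"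
    then have "edge_vector H = edge_vector G" if "score (edge_vector G) \<le> score (edge_vector H)"
      using score_ge_F9_imp_eq[of H "edge_vector G"] y that by simp
    then have "score (edge_vector H) \<le> score (edge_vector G)" by force
    then show "ABC H \<le> ABC G" using H by (simp add: ABC_eq_score chemical_imp_subcubic G)
  qed
qed

section \<open>The minimum\<close>

lemma F8_regular_vector:
  fixes n m p t :: int
  assumes "0 \<le> t" "t \<le> 2" "3 * n - 2 * m = 3 * p + t"
  shows "(3 * n - 2 * m) div 3 = p" "m mod 3 = t" "(7 * m - 6 * n) div 3 = p + 3 * (m - n)"
proof -
  show "(3 * n - 2 * m) div 3 = p" using int_div_pos_eq[OF assms(3)] assms(1,2) by simp
  have "m = 3 * (m - n + p) + t" using assms(3) unfolding int_distrib by linarith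
  then show "m mod 3 = t" by (rule int_mod_pos_eq) (use assms(1,2) in simp_all)
  have "7 * m - 6 * n = 3 * (p + 3 * (m - n)) + t" using assms(3) unfolding int_distrib by linarith
  then show "(7 * m - 6 * n) div 3 = p + 3 * (m - n)" by (rule int_div_pos_eq) (use assms(1,2) in simp_all)
qed

lemma F8_vectors_cases:
  fixes n m :: int
  obtains (tree) p t where "0 \<le> t" "t \<le> 2" "3 * n - 2 * m = 3 * p + t"
      "m + 1 = n" "n \<in> {7, 8, 9}" "p = 3" "t = m - 6"
      "F8_vectors n m = {(2, 0, m - 2, 0, 0), (p, 0, t, p, p + 3 * (m - n))}"
  | (unicyclic) "m = n" "n \<in> {7, 8}" "F8_vectors n m = {(2, 0, m - 7, 4, 1)}"
  | (bicyclic) "n = 7" "m = 8" "F8_vectors n m = {(1, 0, 1, 3, 3)}"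
  | (generic) p t where "0 \<le> t" "t \<le> 2" "3 * n - 2 * m = 3 * p + t"
      "m + 1 = n \<Longrightarrow> n \<notin> {7, 8, 9}" "m = n \<Longrightarrow> n \<notin> {7, 8}" "n = 7 \<Longrightarrow> m \<noteq> 8"
      "F8_vectors n m = {(p, 0, t, p, p + 3 * (m - n))}"
proof -
  define p t where "p = (3 * n - 2 * m) div 3" and "t = (3 * n - 2 * m) mod 3"
  have pt: "0 \<le> t" "t \<le> 2" "3 * n - 2 * m = 3 * p + t" unfolding p_def t_def by simp_all
  consider "m + 1 = n \<and> n \<in> {7, 8, 9}" | "m = n \<and> n \<in> {7, 8}" | "n = 7 \<and> m = 8"
    | "\<not> (m + 1 = n \<and> n \<in> {7, 8, 9})" "\<not> (m = n \<and> n \<in> {7, 8})" "\<not> (n = 7 \<and> m = 8)" by blast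
  then show ?thesis
  proof cases
    case 1
    then have "m = n - 1" "n = 7 \<or> n = 8 \<or> n = 9" by auto
    then have "p = 3" "t = m - 6" using pt by presburger+
    then show ?thesis using tree[OF pt] 1 by (auto simp: F8_vectors_def)
  next
    case 2
    then show ?thesis using unicyclic by (auto simp: F8_vectors_def)
  next
    case 3
    then show ?thesis using bicyclic by (auto simp: F8_vectors_def)
  next
    case 4
    then have "F8_vectors n m = {(p, 0, t, p, p + 3 * (m - n))}"
      unfolding F8_vectors_def F8_regular_vector[OF pt] by (simp only: if_False)
    then show ?thesis using generic[OF pt] 4 by blast
  qed
qed

text \<open>
  Take a graph with p leaves and otherwise cubic vertices, subdivide each pendant edge once, and one of
  them t more times.
\<close>

lemma F8_regular_vector_realizable:
  assumes "admissible n m" and pt: "0 \<le> t" "t \<le> 2" "3 * n - 2 * m = 3 * p + t"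
    and "m = n \<Longrightarrow> n \<notin> {7, 8}" "n = 7 \<Longrightarrow> m \<noteq> 8"
  shows "realizable_vector (p, 0, t, p, p + 3 * (m - n)) \<and> has_order_and_size n m (p, 0, t, p, p + 3 * (m - n))"
proof -
  have nm: "7 \<le> n" "n - 1 \<le> m" "2 * m \<le> 3 * n - 3" using assms(1) by (simp_all add: admissible_def)
  have p: "1 \<le> p" using nm pt by linarith
  have e: "0 \<le> p + 3 * (m - n)" using nm pt by presburger
  have "realizable 0 (nat p) 0 0 (nat (p + 3 * (m - n)))"
  proof (rule core_realizable)
    show "3 \<le> p" if "m - n \<le> 0"
    proof -
      have "m = n - 1 \<or> m = n \<and> 9 \<le> n" using that nm(1,2) assms(5) by auto
      then show ?thesis using nm(1) pt by linarith
    qed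
    show "2 \<le> p" if "m - n = 1"
    proof -
      have mn: "m = n + 1" using that by simp
      then have "n \<noteq> 7" using assms(6) by auto
      then show ?thesis using mn nm(1) pt by linarith
    qed
  qed (use nm p in linarith)+
  then have "realizable (nat p) 0 0 (nat p) (nat (p + 3 * (m - n)))"
    using subdivide_all_13[of 0 0 "nat p" 0 0] by simp
  then have "realizable (nat p) 0 (nat t) (nat p) (nat (p + 3 * (m - n)))"
    using lengthen_pendant_path[of "nat p" 0 0 _ _ "nat t"] p by simp
  then show ?thesis using p e pt by (simp add: realizable_vector_def has_order_and_size_def)
qed

lemma F8_vector_realizable:
  assumes nm: "admissible n m"
  shows "\<exists>y\<in>F8_vectors n m. realizable_vector y \<and> has_order_and_size n m y"
proof (cases rule: F8_vectors_cases[of n m])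
  case (tree p t)
  have "realizable_vector (p, 0, t, p, p + 3 * (m - n)) \<and> has_order_and_size n m (p, 0, t, p, p + 3 * (m - n))"
    by (rule F8_regular_vector_realizable[OF nm tree(1-3)]) (use tree(4) in auto)
  then show ?thesis unfolding tree(8) by blast
next
  case unicyclic
  have "realizable 2 0 0 4 1" using subdivide_all_13[of 0 0 2 0 2 1] bull_realizable
    by (simp add: numeral_eq_Suc)
  then have "realizable 2 0 (nat (m - 7)) 4 1" using lengthen_pendant_path[of 2 0 0 4 1] by simp
  then have "realizable_vector (2, 0, m - 7, 4, 1) \<and> has_order_and_size n m (2, 0, m - 7, 4, 1)"
    using unicyclic by (auto simp: realizable_vector_def has_order_and_size_def)
  then show ?thesis using unicyclic(3) by simp
next
  case bicyclic
  have "realizable 1 0 0 3 3" using subdivide_all_13[of 0 0 1 0 2 3] diamond_with_one_leaf_realizable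
    by (simp add: numeral_eq_Suc)
  then have "realizable 1 0 1 3 3" using lengthen_pendant_path[of 1 0 0 3 3 1] by simp
  then have "realizable_vector (1, 0, 1, 3, 3) \<and> has_order_and_size n m (1, 0, 1, 3, 3)"
    using bicyclic by (simp add: realizable_vector_def has_order_and_size_def)
  then show ?thesis using bicyclic(3) by simp
next
  case (generic p t)
  then show ?thesis using F8_regular_vector_realizable[OF nm generic(1-3,5,6)] by simp
qed

text \<open>
  The number h is half the difference of d and a; it is negative only for the path. In each
  of the unicyclic and bicyclic exceptions three values of (a, b, h) remain, and all but the listed one
  place more edges among the k cubic vertices than a simple graph allows.
\<close>

lemma score_le_F8_imp_mem:
  assumes G: "chemical_graph G"
    and y: "y \<in> F8_vectors (int (graph_order G)) (int (graph_size G))"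
    and le: "score (edge_vector G) \<le> score y"
  shows "edge_vector G \<in> F8_vectors (int (graph_order G)) (int (graph_size G))"
proof -
  define n m where "n = int (graph_order G)" and "m = int (graph_size G)"
  obtain a b c d e where v: "edge_vector G = (a, b, c, d, e)" by (metis surj_pair)
  note cv = chemical_vector[OF G v, folded n_def m_def]
  have eqs: "9 * a + 8 * b + 6 * c + 5 * d + 4 * e = 6 * n" "a + b + c + d + e = m"
    using cv(6) by (auto simp: has_order_and_size_def)
  have nm: "7 \<le> n" "n - 1 \<le> m" "2 * m \<le> 3 * n - 3"
    using chemical_admissible[OF G] by (simp_all add: admissible_def n_def m_def)
  obtain k where k: "3 * k = b + d + 2 * e" "2 * e \<le> k * (k - 1)" using cv(8) by blast
  define h where "h = 3 * n - 2 * m - 3 * a - 2 * b - c"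
  have dh: "d = a + 2 * h" and eh: "e = a + b - h + 3 * (m - n)" using eqs unfolding h_def by algebra+
  have h: "0 \<le> h \<or> (m + 1 = n \<and> (a, b, c, d, e) = (2, 0, m - 2, 0, 0))"
  proof (cases "a \<le> d")
    case True
    then show ?thesis using dh by simp
  next
    case False
    then have z: "b = 0" "d = 0" "e = 0" using cv(7) by auto
    then have "a = 2 * (n - m)" using eqs unfolding int_distrib by linarith
    then have "m + 1 = n" using False z nm unfolding int_distrib by linarith
    then show ?thesis using z eqs by simp
  qed
  have bound: "e' + 2 * b \<le> e \<and> (0 < b \<longrightarrow> e' + 2 * b < e)" if "y = (a', 0, c', d', e')" for a' c' d' e'
    using le v that cv(2) by (intro score_le_imp_more_33_edges) simp_all
  \<comment> \<open>The lower bound on a meets the upper bound from 3a \<le> 3p + t only if nothing is lost.\<close>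
  have gen: "(a, b, c, d, e) = (p, 0, t, p, p + 3 * (m - n))"
    if "0 \<le> h" "0 \<le> t" "t \<le> 2" "3 * n - 2 * m = 3 * p + t" "p + 3 * (m - n) + 2 * b \<le> e" for p t
  proof -
    have L: "3 * a + 2 * b + c + h = 3 * p + t" using that h_def unfolding int_distrib by linarith
    have "p + b + h \<le> a" using that eh unfolding int_distrib by linarith
    then have "a = p" "b = 0" "h = 0" using L that cv(1-5) unfolding int_distrib by linarith+
    then show ?thesis using L dh eh by simp
  qed
  have "edge_vector G \<in> F8_vectors n m"
  proof (cases rule: F8_vectors_cases[of n m])
    case (tree p t)
    have e': "p + 3 * (m - n) = 0" using tree(4,6) by simp
    have "y = (2, 0, m - 2, 0, 0) \<or> y = (p, 0, t, p, 0)"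
      using y[folded n_def m_def] unfolding tree(8) e' by simp
    then have "p + 3 * (m - n) + 2 * b \<le> e" unfolding e' using bound by blast
    then have "(a, b, c, d, e) \<in> {(2, 0, m - 2, 0, 0), (p, 0, t, p, p + 3 * (m - n))}"
      using h gen[OF _ tree(1-3)] by blast
    then show ?thesis unfolding v tree(8) .
  next
    case unicyclic
    then have y': "y = (2, 0, m - 7, 4, 1)" using y[folded n_def m_def] by simp
    have h0: "0 \<le> h" using h unicyclic by simp
    have L: "3 * a + 2 * b + c + h = m" using h_def unicyclic unfolding int_distrib by linarith
    have "1 + b + h \<le> a" "b > 0 \<longrightarrow> 1 + b + h < a" using bound[OF y'] eh unicyclic by auto
    moreover have "a \<le> 2" using L unicyclic h0 cv(1-5) by auto
    ultimately have "b = 0" "(a = 2 \<and> h = 1) \<or> (a = 2 \<and> h = 0) \<or> (a = 1 \<and> h = 0)"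
      using h0 cv(2) by auto
    moreover have "\<not> (a = 2 \<and> h = 0)"
    proof
      assume "a = 2 \<and> h = 0"
      then have "k = 2" "e = 2" using k(1) dh eh \<open>b = 0\<close> unicyclic by auto
      then show False using k(2) by simp
    qed
    moreover have "\<not> (a = 1 \<and> h = 0)"
    proof
      assume "a = 1 \<and> h = 0"
      then have "k = 1" "e = 1" using k(1) dh eh \<open>b = 0\<close> unicyclic by auto
      then show False using k(2) by simp
    qed
    ultimately have "a = 2" "h = 1" "b = 0" by auto
    then show ?thesis using v unicyclic L dh eh by simp
  next
    case bicyclic
    then have y': "y = (1, 0, 1, 3, 3)" using y[folded n_def m_def] by simp
    have h0: "0 \<le> h" using h bicyclic by simp
    have L: "3 * a + 2 * b + c + h = 5" using h_def bicyclic unfolding int_distrib by linarith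
    have "b + h \<le> a" "b > 0 \<longrightarrow> b + h < a" using bound[OF y'] eh bicyclic by auto
    moreover have "a \<le> 1" using L h0 cv(1-5) by auto
    ultimately have "b = 0" "(a = 1 \<and> h = 1) \<or> (a = 1 \<and> h = 0) \<or> (a = 0 \<and> h = 0)"
      using h0 cv(1,2) by auto
    moreover have "\<not> (a = 1 \<and> h = 0)"
    proof
      assume "a = 1 \<and> h = 0"
      then have "k = 3" "e = 4" using k(1) dh eh \<open>b = 0\<close> bicyclic by auto
      then show False using k(2) by simp
    qed
    moreover have "\<not> (a = 0 \<and> h = 0)"
    proof
      assume "a = 0 \<and> h = 0"
      then have "k = 2" "e = 3" using k(1) dh eh \<open>b = 0\<close> bicyclic by auto
      then show False using k(2) by simp
    qed
    ultimately have "a = 1" "h = 1" "b = 0" by auto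
    then show ?thesis using v bicyclic L dh eh by simp
  next
    case (generic p t)
    then have y': "y = (p, 0, t, p, p + 3 * (m - n))" using y[folded n_def m_def] by simp
    have "0 \<le> h"
    proof (rule ccontr)
      assume "\<not> 0 \<le> h"
      then have "m + 1 = n" "e = 0" "b = 0" using h by auto
      \<comment> \<open>From ten vertices on, the optimal tree has a (3,3)-edge, and the path has none.\<close>
      then show False using bound[OF y'] generic nm by auto
    qed
    then have "(a, b, c, d, e) = (p, 0, t, p, p + 3 * (m - n))"
      using gen[OF _ generic(1-3)] bound[OF y'] by blast
    then show ?thesis using v generic(7) by simp
  qed
  then show ?thesis by (simp add: n_def m_def)
qed

lemma score_constant_on_F8_vectors:
  assumes "y \<in> F8_vectors n m" "z \<in> F8_vectors n m"
  shows "score y = score z"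
  by (cases rule: F8_vectors_cases[of n m]) (use assms in \<open>auto simp: score_def\<close>)

lemma minimizes_ABC_iff:
  fixes G :: "'a sgraph"
  assumes G: "chemical_graph G"
  shows "minimizes ABC G \<longleftrightarrow> edge_vector G \<in> F8_vectors (int (graph_order G)) (int (graph_size G))"
proof
  assume min: "minimizes ABC G"
  obtain y where y: "y \<in> F8_vectors (int (graph_order G)) (int (graph_size G))" "realizable_vector y"
      "has_order_and_size (int (graph_order G)) (int (graph_size G)) y"
    using F8_vector_realizable[OF chemical_admissible[OF G]] by blast
  obtain a b c d e where v: "y = (a, b, c, d, e)" by (metis surj_pair)
  obtain H :: "'a sgraph" where H: "chemical_graph H" "graph_order H = graph_order G"
      "graph_size H = graph_size G" "edge_vector H = y"
    using chemical_graph_with_vector[OF G y(2)[unfolded v]] y(3) unfolding v has_order_and_size_def by auto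
  have "ABC G \<le> ABC H" using min H unfolding minimizes_def by blast
  then have "score (edge_vector G) \<le> score y"
    using H by (simp add: ABC_eq_score chemical_imp_subcubic G)
  then show "edge_vector G \<in> F8_vectors (int (graph_order G)) (int (graph_size G))"
    using score_le_F8_imp_mem[OF G y(1)] by simp
next
  assume y: "edge_vector G \<in> F8_vectors (int (graph_order G)) (int (graph_size G))"
  show "minimizes ABC G"
    unfolding minimizes_def
  proof (intro allI impI)
    fix H :: "'a sgraph"
    assume H: "chemical_graph H \<and> graph_order H = graph_order G \<and> graph_size H = graph_size G"
    have "score (edge_vector H) = score (edge_vector G)" if "score (edge_vector H) \<le> score (edge_vector G)"
      using score_le_F8_imp_mem[of H "edge_vector G"] score_constant_on_F8_vectors y H that by metis
    then have "score (edge_vector G) \<le> score (edge_vector H)" by force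
    then show "ABC G \<le> ABC H" using H by (simp add: ABC_eq_score chemical_imp_subcubic G)
  qed
qed

theorem corollary19:
  "{G :: 'a sgraph. extremal ABC G} = F8 \<union> F9"
  by (auto simp: extremal_def F8_def F9_def maximizes_ABC_iff minimizes_ABC_iff)

end
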